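(* Let $n\in\mathbb N_0$, $\gamma\in\mathbb C$, $\alpha,\beta\in(-1,1)\setminus\{0\}$, $0<|q|<1$, $|t|<1-\beta^2$. Then, with $x=\cos\theta$, $$\int_{-1}^1\frac{(\gamma te^{i\theta};q)_\infty}{(te^{i\theta};q)_\infty}\;{}_3\phi_2\!\left(\gamma,\beta,\beta e^{2i\theta};\ \beta^2,\gamma te^{i\theta};\ q,te^{-i\theta}\right)C_n(x;\alpha|q)\frac{w(x;\alpha|q)}{\sqrt{1-x^2}}\,dx$$ $$=2\pi t^n\frac{(\alpha,q\alpha;q)_\infty(\alpha^2,\gamma,\beta;q)_n}{(\alpha^2,q;q)_\infty(q,\beta^2,q\alpha;q)_n}\;{}_6\phi_5\!\left(\beta/\alpha,\beta q^n,\pm(\gamma q^n)^{1/2},\pm(\gamma q^{n+1})^{1/2};\ \alpha q^{n+1},\pm\beta q^{n/2},\pm\beta q^{(n+1)/2};\ q,\alpha t^2\right).$$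
   Context: Notation: $\mathbb N_0=\{0,1,2,\dots\}$, $(a;q)_0=1$, $(a;q)_n=\prod_{j=0}^{n-1}(1-aq^j)$, $(a;q)_\infty=\prod_{j\ge0}(1-aq^j)$, $(a_1,\dots,a_r;q)_n=\prod_i(a_i;q)_n$ (also for $n=\infty$). In a list of parameters, $\pm a$ stands for the two entries $a,-a$. The basic hypergeometric series, with upper parameters listed before the first semicolon and lower parameters before the second, is $${}_r\phi_s(a_1,\dots,a_r;b_1,\dots,b_s;q,z)=\sum_{k=0}^\infty\frac{(a_1,\dots,a_r;q)_k}{(q,b_1,\dots,b_s;q)_k}\left((-1)^kq^{\binom k2}\right)^{1+s-r}z^k.$$ The continuous $q$-ultraspherical/Rogers polynomials are, for $x=\cos\theta$, $$C_n(x;\beta|q)=\frac{(\beta;q)_n}{(q;q)_n}e^{in\theta}\,{}_2\phi_1\!\left(q^{-n},\beta;\beta^{-1}q^{1-n};q,q\beta^{-1}e^{-2i\theta}\right),$$ and the weight function $w$ on $(-1,1)$ is $$w(x;\beta|q)=\left|\frac{(e^{2i\theta};q)_\infty}{(\beta e^{2i\theta};q)_\infty}\right|^2.$$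
   Formalization: The base q is taken to be real with 0<|q|<1; for non-real q the identity fails with w defined as a squared modulus (at n=0, t=0, q=i/2 and small α the left side is real, the right side is not). *)

theory Defs
  imports "HOL-Analysis.Analysis"
begin

definition qpoch :: "complex \<Rightarrow> complex \<Rightarrow> nat \<Rightarrow> complex" where
  "qpoch a q n = (\<Prod>j<n. 1 - a * q ^ j)"

definition qpoch_inf :: "complex \<Rightarrow> complex \<Rightarrow> complex" where
  "qpoch_inf a q = (\<Prod>j. 1 - a * q ^ j)"

definition qpochs :: "complex list \<Rightarrow> complex \<Rightarrow> nat \<Rightarrow> complex" where
  "qpochs as q n = (\<Prod>a\<leftarrow>as. qpoch a q n)"

definition qpochs_inf :: "complex list \<Rightarrow> complex \<Rightarrow> complex" where
  "qpochs_inf as q = (\<Prod>a\<leftarrow>as. qpoch_inf a q)"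

(* The exponent 1 + s - r may be negative, hence the integer power. *)
definition basic_hyp :: "complex list \<Rightarrow> complex list \<Rightarrow> complex \<Rightarrow> complex \<Rightarrow> complex" where
  "basic_hyp as bs q z =
    (\<Sum>k. qpochs as q k / qpochs (q # bs) q k *
         ((-1) ^ k * q ^ (k choose 2)) powi (1 + int (length bs) - int (length as)) * z ^ k)"

(* Continuous q-ultraspherical (Rogers) polynomials. The 2phi1 terminates: for k > n the factor
   (q^(-n);q)_k vanishes, so the summand is 0 even where its denominator is also 0 (x / 0 = 0). *)
definition rogers_poly :: "nat \<Rightarrow> real \<Rightarrow> complex \<Rightarrow> complex \<Rightarrow> complex" where
  "rogers_poly n x \<beta> q =
    (let \<theta> = arccos x in
       qpoch \<beta> q n / qpoch q q n * cis (real n * \<theta>) *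
       basic_hyp [q powi (- int n), \<beta>] [inverse \<beta> * q powi (1 - int n)]
         q (q * inverse \<beta> * cis (- 2 * \<theta>)))"

definition rogers_weight :: "real \<Rightarrow> complex \<Rightarrow> complex \<Rightarrow> real" where
  "rogers_weight x \<beta> q =
    (let \<theta> = arccos x in
       (norm (qpoch_inf (cis (2 * \<theta>)) q / qpoch_inf (\<beta> * cis (2 * \<theta>)) q))\<^sup>2)"

end

theory Submission
  imports Defs
begin

text \<open>
  Put \<open>z = cis \<theta>\<close>, \<open>w = cis (- \<theta>)\<close>, and let \<open>c\<^sub>k = (\<beta>;q)\<^sub>k / (q;q)\<^sub>k\<close> be the coefficients of the
  \<open>q\<close>-binomial series. The Rogers polynomial is the homogeneous sum of \<open>c\<^sub>k c\<^sub>m\<^sub>-\<^sub>k z\<^sup>m\<^sup>-\<^sup>k w\<^sup>k\<close>, and the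
  theorem is the integrated form of three facts about it.

  \<^item> The \<open>3\<phi>2\<close> of the integrand, with the infinite products before it, is the generating function of
    \<open>(\<gamma>;q)\<^sub>m / (\<beta>\<^sup>2;q)\<^sub>m C\<^sub>m(x;\<beta>|q) t\<^sup>m\<close> (\<open>rogers_generating_function\<close>): expanding each shifted
    quotient of infinite products by the \<open>q\<close>-binomial theorem and collecting powers of \<open>t\<close> leaves a
    finite identity, which the \<open>q\<close>-Chu--Vandermonde sum proves coefficientwise.
  \<^item> \<open>C\<^sub>m(x;\<beta>|q)\<close> is an explicit combination of the \<open>C\<^bsub>m-2k\<^esub>(x;\<alpha>|q)\<close> (\<open>rogers_connection\<close>).
    Comparing coefficients of \<open>z\<^sup>i w\<^sup>j\<close> reduces this to a terminating very-well-poised sum.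
  \<^item> The \<open>C\<^sub>m(x;\<alpha>|q)\<close> are orthogonal for the weight in the integrand (\<open>rogers_orthogonal\<close>).

  Integrating the generating function term by term against \<open>C\<^sub>n(x;\<alpha>|q)\<close>, only the degrees \<open>m = n + 2k\<close>
  survive, each through a single connection coefficient. The resulting series in \<open>k\<close> is the \<open>6\<phi>5\<close>,
  because \<open>(c;q)\<^sub>2\<^sub>k\<close> splits into the four factors with parameters \<open>\<plusminus>c\<^sup>1\<^sup>/\<^sup>2\<close>, \<open>\<plusminus>(cq)\<^sup>1\<^sup>/\<^sup>2\<close>.

  For the orthogonality, let \<open>y = z\<^sup>2\<close>. The weight is \<open>(1 - y) (1 - 1/y) h(y) h(1/y)\<close> with
  \<open>h(y) = (qy;q)\<^sub>\<infinity> / (\<alpha>y;q)\<^sub>\<infinity>\<close>. Dropping the factor \<open>1 - 1/y\<close> leaves a function whose Fourier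
  coefficients \<open>E\<^sub>p\<close> satisfy a two-term recurrence and \<open>E\<^bsub>-p-1\<^esub> = - E\<^sub>p\<close>. The antisymmetry makes the
  dropped factor count as a factor 2 on polynomials symmetric in \<open>z\<close> and \<open>1/z\<close>, and the recurrence
  turns the moments of \<open>C\<^sub>n\<close> into balanced sums of \<open>q\<close>-Saalschuetz type, whose value contains a
  factor vanishing for every moment of lower degree. The normalisation \<open>E\<^sub>0\<close> follows by running the
  recurrence to infinity.
\<close>

section \<open>Finite q-shifted factorials\<close>

lemma qpoch_0 [simp]: "qpoch a q 0 = 1"
  by (simp add: qpoch_def)

lemma qpoch_Suc: "qpoch a q (Suc n) = qpoch a q n * (1 - a * q ^ n)"
  by (simp add: qpoch_def)

lemma qpoch_add: "qpoch a q (m + n) = qpoch a q m * qpoch (a * q ^ m) q n"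
  by (induction n) (simp_all add: qpoch_Suc power_add mult_ac)

lemma qpoch_Suc_left: "qpoch a q (Suc n) = (1 - a) * qpoch (a * q) q n"
  using qpoch_add[of a q 1 n] by (simp add: qpoch_Suc)

lemma one_minus_nonzero:
  fixes a q :: complex
  assumes "norm a < 1" "norm q < 1"
  shows "1 - a * q ^ k \<noteq> 0"
proof
  assume "1 - a * q ^ k = 0"
  then have "norm (a * q ^ k) = 1" by simp
  moreover have "norm a * norm q ^ k \<le> norm a * 1"
    using assms by (intro mult_left_mono power_le_one) auto
  ultimately show False using assms by (simp add: norm_mult norm_power)
qed

lemma one_minus_power_nonzero:
  fixes q :: complex
  assumes "norm q < 1"
  shows "1 - q * q ^ k \<noteq> 0"
  using one_minus_nonzero[OF assms assms] .

lemma qpoch_nonzero: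
  assumes "norm a < 1" "norm q < 1"
  shows "qpoch a q n \<noteq> 0"
  using one_minus_nonzero[OF assms] by (simp add: qpoch_def)

text \<open>These numbers serve twice: as the coefficients of the \<open>q\<close>-binomial series and, for the same
  reason, as the coefficients whose convolution gives the Rogers polynomials.\<close>
definition qbinom_coeff :: "complex \<Rightarrow> complex \<Rightarrow> nat \<Rightarrow> complex" where
  "qbinom_coeff a q k = qpoch a q k / qpoch q q k"

lemma qbinom_coeff_0 [simp]: "qbinom_coeff a q 0 = 1"
  by (simp add: qbinom_coeff_def)

lemma qbinom_coeff_Suc:
  assumes "norm q < 1"
  shows "(1 - q * q ^ k) * qbinom_coeff a q (Suc k) = (1 - a * q ^ k) * qbinom_coeff a q k"
  using one_minus_power_nonzero[OF assms, of k] qpoch_nonzero[OF assms assms, of k]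
  by (simp add: qbinom_coeff_def qpoch_Suc divide_simps)

section \<open>Terminating summation identities\<close>

text \<open>The inductions below pass from sums of length \<open>p\<close> to length \<open>p + 1\<close> by writing each summand of the
  longer sum as \<open>A i + B i\<close> with \<open>B\<close> starting one index later; this lemma realigns the two parts.\<close>
lemma sum_shift_split:
  fixes A B :: "nat \<Rightarrow> 'a::comm_monoid_add"
  assumes "A (Suc p) = 0" "B 0 = 0"
  shows "(\<Sum>i\<le>Suc p. A i + B i) = (\<Sum>i\<le>p. A i + B (Suc i))"
proof -
  have "(\<Sum>i\<le>Suc p. A i + B i) = (\<Sum>i\<le>Suc p. A i) + (\<Sum>i\<le>Suc p. B i)"
    by (rule sum.distrib)
  also have "(\<Sum>i\<le>Suc p. A i) = (\<Sum>i\<le>p. A i)" using assms by simp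
  also have "(\<Sum>i\<le>Suc p. B i) = (\<Sum>i\<le>p. B (Suc i))"
    using assms by (subst sum.atMost_Suc_shift) simp
  finally show ?thesis by (simp add: sum.distrib)
qed

text \<open>The \<open>q\<close>-Chu--Vandermonde sum with lower parameter \<open>a b\<close>, cleared of the denominator
  \<open>(a b;q)\<^sub>p\<close> so that it is a polynomial identity in \<open>a\<close> and \<open>b\<close> and survives \<open>a = 0\<close>. The \<open>q\<close>-Pascal
  rule reduces length \<open>p + 1\<close> at \<open>a\<close> to length \<open>p\<close> at \<open>a\<close> and at \<open>a q\<close>; hence the induction with
  arbitrary \<open>a\<close>.\<close>
lemma q_chu_vandermonde:
  assumes q: "norm q < 1"
  shows "(\<Sum>i\<le>p. (- b) ^ i * q ^ (i choose 2) * qpoch a q i * qpoch (a * b * q ^ i) q (p - i)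
            / (qpoch q q i * qpoch q q (p - i))) = qbinom_coeff b q p"
proof (induction p arbitrary: a)
  case 0
  then show ?case by (simp add: numeral_2_eq_2)
next
  case (Suc p)
  define u where "u p a i = (- b) ^ i * q ^ (i choose 2) * qpoch a q i * qpoch (a * b * q ^ i) q (p - i)
            / (qpoch q q i * qpoch q q (p - i))" for p a i
  note nz = one_minus_power_nonzero[OF q] qpoch_nonzero[OF q q]
  define A where "A i = (if i \<le> p then (1 - a * b * q ^ p) * u p a i else 0)" for i
  define B where "B i = (if i = 0 then 0 else - b * q ^ p * (1 - a) * u p (a * q) (i - 1))" for i
  have split: "(1 - q * q ^ p) * u (Suc p) a i = A i + B i" if i: "i \<le> Suc p" for i
  proof -
    have 1: "(1 - q ^ (Suc p - i)) * u (Suc p) a i = A i"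
    proof (cases "i \<le> p")
      case True
      then obtain d where d: "p = i + d" using le_Suc_ex by blast
      have "Suc (i + d) - i = Suc d" by simp
      then show ?thesis using nz[of d] nz(2)[of i]
        unfolding u_def A_def d by (simp add: qpoch_Suc power_add divide_simps)
    next
      case False
      then have "i = Suc p" using i by simp
      then show ?thesis by (simp add: A_def)
    qed
    have 2: "q ^ (Suc p - i) * (1 - q ^ i) * u (Suc p) a i = B i"
    proof (cases i)
      case 0
      then show ?thesis by (simp add: B_def)
    next
      case (Suc j)
      then obtain d where d: "p = j + d" using i le_Suc_ex by auto
      have c: "Suc j choose 2 = j + (j choose 2)" by (simp add: numeral_2_eq_2)
      have e: "qpoch a q (Suc j) = (1 - a) * qpoch (a * q) q j" by (rule qpoch_Suc_left)
      have f: "a * b * q ^ Suc j = a * q * b * q ^ j" by simp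
      show ?thesis using nz[of j] nz(2)[of d]
        unfolding u_def B_def d Suc c e f
        by (simp add: qpoch_Suc[of q] power_add divide_simps)
    qed
    \<comment> \<open>The \<open>q\<close>-Pascal rule for the \<open>q\<close>-binomial coefficient hidden in the denominators.\<close>
    have "1 - q * q ^ p = (1 - q ^ (Suc p - i)) + q ^ (Suc p - i) * (1 - q ^ i)"
      using i by (simp add: algebra_simps flip: power_add power_Suc)
    then show ?thesis using 1 2 by (simp only: distrib_right mult.assoc)
  qed
  have "(1 - q * q ^ p) * (\<Sum>i\<le>Suc p. u (Suc p) a i) = (\<Sum>i\<le>Suc p. A i + B i)"
    unfolding sum_distrib_left by (intro sum.cong split) auto
  also have "\<dots> = (\<Sum>i\<le>p. A i + B (Suc i))"
    by (rule sum_shift_split) (simp_all add: A_def B_def)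
  also have "\<dots> = (1 - a * b * q ^ p) * (\<Sum>i\<le>p. u p a i) - b * q ^ p * (1 - a) * (\<Sum>i\<le>p. u p (a * q) i)"
    unfolding sum_distrib_left sum_subtractf[symmetric]
    by (intro sum.cong) (simp_all add: A_def B_def)
  also have "\<dots> = (1 - b * q ^ p) * qbinom_coeff b q p"
    using Suc.IH[of a] Suc.IH[of "a * q"] unfolding u_def by (simp add: algebra_simps)
  also have "\<dots> = (1 - q * q ^ p) * qbinom_coeff b q (Suc p)"
    by (rule qbinom_coeff_Suc[OF q, symmetric])
  finally show ?case using nz(1)[of p] unfolding u_def by simp
qed

text \<open>The first-order recurrence in \<open>n\<close> behind the \<open>q\<close>-Saalschuetz sum. Up to a constant, \<open>X k\<close> stands for
  \<open>(u/a;q)\<^sub>k a\<^sup>k / (a u;q)\<^sub>k\<close>, but it enters only through its two-term recurrence and nothing is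
  divided by \<open>1 - a u q\<^sup>n\<close>. So the step remains valid when such a factor vanishes, which happens
  for \<open>a\<close> equal to a power of \<open>q\<close>.\<close>
lemma saalschuetz_step:
  assumes q: "norm q < 1"
    and X: "\<And>k. X (Suc k) * (1 - a * u * q ^ k) = X k * (a - u * q ^ k)"
  shows "(1 - q * q ^ n) * (1 - a * u * q ^ n) *
           (\<Sum>k\<le>Suc n. qbinom_coeff a q k * qbinom_coeff a q (Suc n - k) * X k)
       = (1 - a\<^sup>2 * q ^ n) * (1 - u * q ^ n) *
           (\<Sum>k\<le>n. qbinom_coeff a q k * qbinom_coeff a q (n - k) * X k)"
proof -
  let ?c = "qbinom_coeff a q"
  note rec = qbinom_coeff_Suc[OF q, where a = a]
  \<comment> \<open>The Wilf--Zeilberger certificate: the difference of the two sides telescopes, with \<open>- G k\<close> as the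
    partial sum up to \<open>k\<close>.\<close>
  define G where "G k = q ^ (n - k) * (1 - a * q ^ k) * (a - u * q ^ k) * ?c k * ?c (n - k) * X k" for k
  define A where "A k = (if k \<le> n then (1 - a\<^sup>2 * q ^ n) * (1 - u * q ^ n) * (?c k * ?c (n - k) * X k) - G k else 0)" for k
  define B where "B k = (if k = 0 then 0 else G (k - 1))" for k
  have split: "(1 - q * q ^ n) * (1 - a * u * q ^ n) * (?c k * ?c (Suc n - k) * X k) = A k + B k"
    if k: "k \<le> Suc n" for k
  proof (cases "k \<le> n")
    case True
    then obtain d where d: "n = k + d" using le_Suc_ex by blast
    have s: "Suc (k + d) - k = Suc d" by simp
    have B: "B k = q ^ d * (1 - q ^ k) * (q - a * u * q ^ k) * (?c k * ?c (Suc d) * X k)"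
    proof (cases k)
      case 0
      then show ?thesis by (simp add: B_def)
    next
      case (Suc j)
      have "n - j = Suc d" using d Suc by simp
      then have "B k = q * q ^ d * ((1 - a * q ^ j) * ?c j) * ?c (Suc d) * (X j * (a - u * q ^ j))"
        by (simp add: B_def G_def Suc)
      also have "\<dots> = q * q ^ d * ((1 - q * q ^ j) * ?c k) * ?c (Suc d) * (X k * (1 - a * u * q ^ j))"
        unfolding rec[symmetric] X[symmetric] Suc ..
      finally show ?thesis using Suc by (simp add: algebra_simps)
    qed
    have "(1 - q * q ^ n) * (1 - a * u * q ^ n) * (?c k * ?c (Suc d) * X k) - B k
        = ((1 - q * q ^ d) * ?c (Suc d)) * ((1 - a * u * q ^ k * q ^ n) * ?c k * X k)"
      unfolding B d power_add by (simp add: algebra_simps)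
    also have "\<dots> = ((1 - a * q ^ d) * ?c d) * ((1 - a * u * q ^ k * q ^ n) * ?c k * X k)"
      unfolding rec ..
    also have "\<dots> = A k"
      unfolding A_def G_def d using True by (simp add: power_add power2_eq_square algebra_simps)
    finally show ?thesis unfolding d s by (simp only: diff_eq_eq)
  next
    case False
    then have "k = Suc n" using k by simp
    then have "A k + B k = ((1 - a * q ^ n) * ?c n) * (X n * (a - u * q ^ n))"
      by (simp add: A_def B_def G_def)
    also have "\<dots> = ((1 - q * q ^ n) * ?c (Suc n)) * (X (Suc n) * (1 - a * u * q ^ n))"
      unfolding rec[symmetric] X[symmetric] ..
    finally show ?thesis using \<open>k = Suc n\<close> by (simp add: mult_ac)
  qed
  have "(1 - q * q ^ n) * (1 - a * u * q ^ n) * (\<Sum>k\<le>Suc n. ?c k * ?c (Suc n - k) * X k)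
      = (\<Sum>k\<le>Suc n. A k + B k)"
    unfolding sum_distrib_left by (intro sum.cong split) auto
  also have "\<dots> = (\<Sum>k\<le>n. A k + B (Suc k))"
    by (rule sum_shift_split) (simp_all add: A_def B_def)
  also have "\<dots> = (1 - a\<^sup>2 * q ^ n) * (1 - u * q ^ n) * (\<Sum>k\<le>n. ?c k * ?c (n - k) * X k)"
    unfolding sum_distrib_left by (intro sum.cong) (simp_all add: A_def B_def)
  finally show ?thesis .
qed

text \<open>The Rogers polynomial in the form symmetric under exchange of \<open>z\<close> and \<open>w\<close>; on the unit circle
  \<open>w = 1/z\<close>.\<close>
definition rogers_sum :: "complex \<Rightarrow> complex \<Rightarrow> nat \<Rightarrow> complex \<Rightarrow> complex \<Rightarrow> complex" where
  "rogers_sum a q m z w = (\<Sum>k\<le>m. qbinom_coeff a q k * qbinom_coeff a q (m - k) * z ^ (m - k) * w ^ k)"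

definition connection_coeff :: "complex \<Rightarrow> complex \<Rightarrow> complex \<Rightarrow> nat \<Rightarrow> nat \<Rightarrow> complex" where
  "connection_coeff a b q m k = a ^ k * qbinom_coeff (b / a) q k
     * qpoch b q (m - k) * (1 - a * q ^ (m - 2 * k)) / qpoch a q (Suc (m - k))"

text \<open>The terminating very-well-poised \<open>6\<phi>5\<close> sum, in the form in which it arises when the connection
  formula is compared at \<open>z\<^sup>i w\<^sup>j\<close>. Induction on \<open>j\<close> by a Wilf--Zeilberger pair; since \<open>j \<le> i\<close>, no
  index in \<open>i - k\<close> is truncated.\<close>
lemma connection_coeffs_product_ge:
  assumes q: "norm q < 1" and a: "a \<noteq> 0" "norm a < 1" and le: "j \<le> i"
  shows "(\<Sum>k\<le>j. connection_coeff a b q (i + j) k * qbinom_coeff a q (i - k) * qbinom_coeff a q (j - k))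
       = qbinom_coeff b q i * qbinom_coeff b q j"
  using le
proof (induction j)
  case 0
  have "qpoch a q i \<noteq> 0" "1 - a * q ^ i \<noteq> 0"
    using qpoch_nonzero one_minus_nonzero a q by auto
  then show ?case
    by (simp add: connection_coeff_def qbinom_coeff_def qpoch_Suc)
next
  case (Suc j)
  let ?c = "qbinom_coeff a q" and ?e = "\<lambda>k. a ^ k * qbinom_coeff (b / a) q k"
  note rec = qbinom_coeff_Suc[OF q, where a = a]
  have erec: "(1 - q * q ^ k) * ?e (Suc k) = (a - b * q ^ k) * ?e k" for k
  proof -
    have "(1 - q * q ^ k) * ?e (Suc k) = a * a ^ k * ((1 - q * q ^ k) * qbinom_coeff (b / a) q (Suc k))"
      by simp
    also have "\<dots> = (a - b * q ^ k) * ?e k"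
      unfolding qbinom_coeff_Suc[OF q] using a by (simp add: field_simps)
    finally show ?thesis .
  qed
  define r where "r m = qpoch b q m / qpoch a q (Suc m)" for m
  have nza: "1 - a * q ^ m \<noteq> 0" for m by (rule one_minus_nonzero[OF a(2) q])
  have rrec: "(1 - a * q ^ Suc m) * r (Suc m) = (1 - b * q ^ m) * r m" for m
    using nza[of "Suc m"] qpoch_nonzero[OF a(2) q, of "Suc m"]
    unfolding r_def by (simp add: qpoch_Suc[of _ _ "Suc m"] qpoch_Suc[of b] divide_simps del: power_Suc)
  define t where "t j k = ?e k * r (i + j - k) * (1 - a * q ^ (i + j - 2 * k)) * ?c (i - k) * ?c (j - k)" for j k
  have t: "connection_coeff a b q (i + j) k * ?c (i - k) * ?c (j - k) = t j k" for j k
    by (simp add: t_def connection_coeff_def r_def)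
  \<comment> \<open>The certificate: \<open>(1 - q\<^sup>j\<^sup>+\<^sup>1) t (j + 1) k - (1 - b q\<^sup>j) t j k = G (k - 1) - G k\<close>.\<close>
  define G where "G k = q ^ (j - k) * (a - b * q ^ k) * (1 - q ^ (i - k)) * ?e k * r (i + j - k) * ?c (i - k) * ?c (j - k)" for k
  define A where "A k = (if k \<le> j then (1 - b * q ^ j) * t j k - G k else 0)" for k
  define B where "B k = (if k = 0 then 0 else G (k - 1))" for k
  have split: "(1 - q * q ^ j) * t (Suc j) k = A k + B k" if k: "k \<le> Suc j" for k
  proof (cases "k \<le> j")
    case True
    then obtain d where d: "j = k + d" using le_Suc_ex by blast
    obtain h where h: "i = k + h" using True Suc.prems le_Suc_ex by (metis Suc_leD le_trans)
    define R where "R = r (k + h + d)"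
    define R' where "R' = r (Suc (k + h + d))"
    have R: "(1 - a * q ^ Suc (k + h + d)) * R' = (1 - b * q ^ (k + h + d)) * R"
      unfolding R_def R'_def by (rule rrec)
    have s: "Suc (k + d) - k = Suc d" "k + h - k = h" "k + h + Suc (k + d) - k = Suc (k + h + d)"
      "k + h + Suc (k + d) - 2 * k = Suc (h + d)" "k + h + (k + d) - k = k + h + d"
      "k + h + (k + d) - 2 * k = h + d" "k + d - k = d" by auto
    have B: "B k = q * q ^ d * (1 - q ^ k) * (1 - a * q ^ h) * ?e k * R' * ?c h * ?c (Suc d)"
    proof (cases k)
      case 0
      then show ?thesis by (simp add: B_def)
    next
      case (Suc l)
      have s': "j - l = Suc d" "i - l = Suc h" "i + j - l = Suc (k + h + d)" using d h Suc by auto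
      have "B k = q * q ^ d * ((a - b * q ^ l) * ?e l) * ((1 - q * q ^ h) * ?c (Suc h)) * R' * ?c (Suc d)"
        unfolding B_def G_def s' R'_def using Suc s' by (simp add: mult_ac)
      also have "\<dots> = q * q ^ d * ((1 - q * q ^ l) * ?e k) * ((1 - a * q ^ h) * ?c h) * R' * ?c (Suc d)"
        unfolding erec[symmetric] rec Suc ..
      finally show ?thesis using Suc by (simp add: mult_ac)
    qed
    have "(1 - q * q ^ j) * t (Suc j) k - B k = ?e k * ?c h * ?c (Suc d) * R' *
        ((1 - q * q ^ j) * (1 - a * q ^ Suc (h + d)) - q * q ^ d * (1 - q ^ k) * (1 - a * q ^ h))"
      unfolding B t_def d h s R'_def by (simp add: algebra_simps)
    also have "(1 - q * q ^ j) * (1 - a * q ^ Suc (h + d)) - q * q ^ d * (1 - q ^ k) * (1 - a * q ^ h)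
        = (1 - q * q ^ d) * (1 - a * q ^ Suc (k + h + d))"
      unfolding d by (simp add: power_add algebra_simps)
    also have "?e k * ?c h * ?c (Suc d) * R' * ((1 - q * q ^ d) * (1 - a * q ^ Suc (k + h + d)))
        = ?e k * ?c h * ((1 - q * q ^ d) * ?c (Suc d)) * ((1 - a * q ^ Suc (k + h + d)) * R')"
      by (simp only: mult_ac)
    also have "\<dots> = ?e k * ?c h * ((1 - a * q ^ d) * ?c d) * ((1 - b * q ^ (k + h + d)) * R)"
      unfolding rec R ..
    also have "\<dots> = A k"
      unfolding A_def G_def t_def d h s R_def using True by (simp add: power_add algebra_simps)
    finally show ?thesis by (simp only: diff_eq_eq)
  next
    case False
    then have kj: "k = Suc j" using k by simp
    then obtain h where h: "i = Suc j + h" using Suc.prems le_Suc_ex by blast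
    have s: "i - j = Suc h" "i - Suc j = h" "i + j - j = i" "i + Suc j - Suc j = i" "i + Suc j - 2 * Suc j = h"
      using h by auto
    have "A k + B k = ((a - b * q ^ j) * ?e j) * ((1 - q * q ^ h) * ?c (Suc h)) * r i"
      using kj s by (simp add: A_def B_def G_def)
    also have "\<dots> = ((1 - q * q ^ j) * ?e (Suc j)) * ((1 - a * q ^ h) * ?c h) * r i"
      unfolding erec[symmetric] rec ..
    also have "\<dots> = (1 - q * q ^ j) * t (Suc j) k"
      unfolding t_def kj s by simp
    finally show ?thesis ..
  qed
  have "(1 - q * q ^ j) * (\<Sum>k\<le>Suc j. t (Suc j) k) = (\<Sum>k\<le>Suc j. A k + B k)"
    unfolding sum_distrib_left by (intro sum.cong split) auto
  also have "\<dots> = (\<Sum>k\<le>j. A k + B (Suc k))"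
    by (rule sum_shift_split) (simp_all add: A_def B_def)
  also have "\<dots> = (1 - b * q ^ j) * (\<Sum>k\<le>j. t j k)"
    unfolding sum_distrib_left by (intro sum.cong) (simp_all add: A_def B_def)
  also have "\<dots> = (1 - b * q ^ j) * (qbinom_coeff b q i * qbinom_coeff b q j)"
    using Suc unfolding t by simp
  also have "\<dots> = qbinom_coeff b q i * ((1 - q * q ^ j) * qbinom_coeff b q (Suc j))"
    unfolding qbinom_coeff_Suc[OF q] by simp
  finally have "(1 - q * q ^ j) * (\<Sum>k\<le>Suc j. t (Suc j) k)
      = (1 - q * q ^ j) * (qbinom_coeff b q i * qbinom_coeff b q (Suc j))" by simp
  then show ?case
    using one_minus_power_nonzero[OF q, of j] unfolding t by simp
qed

lemma connection_coeffs_product: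
  assumes q: "norm q < 1" and a: "a \<noteq> 0" "norm a < 1"
  shows "(\<Sum>k\<le>min i j. connection_coeff a b q (i + j) k * qbinom_coeff a q (i - k) * qbinom_coeff a q (j - k))
       = qbinom_coeff b q i * qbinom_coeff b q j"
proof (cases "j \<le> i")
  case True
  then show ?thesis using connection_coeffs_product_ge[OF q a True] by (simp add: min_absorb2)
next
  case False
  then show ?thesis using connection_coeffs_product_ge[OF q a, where i = j and j = i and b = b]
    by (simp add: min_absorb1 add.commute mult_ac)
qed

lemma rogers_connection:
  assumes q: "norm q < 1" and a: "a \<noteq> 0" "norm a < 1" and zw: "z * w = 1"
  shows "rogers_sum b q m z w
       = (\<Sum>k\<le>m div 2. connection_coeff a b q m k * rogers_sum a q (m - 2 * k) z w)"
proof -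
  let ?c = "qbinom_coeff a q"
  define f where "f i k = connection_coeff a b q m k * ?c (i - k) * ?c (m - i - k) * z ^ (m - i) * w ^ i" for i k
  have "rogers_sum b q m z w = (\<Sum>i\<le>m. \<Sum>k\<le>min i (m - i). f i k)"
    unfolding rogers_sum_def
  proof (rule sum.cong)
    fix i assume "i \<in> {..m}"
    then have "qbinom_coeff b q i * qbinom_coeff b q (m - i)
        = (\<Sum>k\<le>min i (m - i). connection_coeff a b q m k * ?c (i - k) * ?c (m - i - k))"
      using connection_coeffs_product[OF q a, where i = i and j = "m - i" and b = b] by simp
    then show "qbinom_coeff b q i * qbinom_coeff b q (m - i) * z ^ (m - i) * w ^ i
        = (\<Sum>k\<le>min i (m - i). f i k)"
      by (simp add: f_def sum_distrib_right)
  qed auto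
  also have "\<dots> = (\<Sum>(i, k)\<in>(SIGMA i:{..m}. {..min i (m - i)}). f i k)"
    by (rule sum.Sigma) auto
  \<comment> \<open>Collect the terms belonging to the same \<open>C\<^bsub>m-2k\<^esub>\<close>; each lost the factor \<open>(z w)\<^sup>k = 1\<close>.\<close>
  also have "\<dots> = (\<Sum>(k, l)\<in>(SIGMA k:{..m div 2}. {..m - 2 * k}). f (l + k) k)"
    by (rule sum.reindex_bij_witness[where i = "\<lambda>(k, l). (l + k, k)" and j = "\<lambda>(i, k). (k, i - k)"]) auto
  also have "\<dots> = (\<Sum>k\<le>m div 2. \<Sum>l\<le>m - 2 * k. f (l + k) k)"
    by (rule sum.Sigma[symmetric]) auto
  also have "\<dots> = (\<Sum>k\<le>m div 2. connection_coeff a b q m k * rogers_sum a q (m - 2 * k) z w)"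
  proof (intro sum.cong refl)
    fix k assume k: "k \<in> {..m div 2}"
    have "f (l + k) k = connection_coeff a b q m k * (?c l * ?c (m - 2 * k - l) * z ^ (m - 2 * k - l) * w ^ l)"
      if l: "l \<in> {..m - 2 * k}" for l
    proof -
      have "2 * k + l \<le> m" using k l by simp
      then obtain d where d: "m = 2 * k + l + d" using le_Suc_ex by blast
      have s: "m - (l + k) = d + k" "m - (l + k) - k = d" "m - 2 * k - l = d" using d by auto
      have "z ^ (d + k) * w ^ (l + k) = z ^ d * w ^ l * (z * w) ^ k"
        by (simp add: power_add power_mult_distrib mult_ac)
      then show ?thesis unfolding f_def s using zw by (simp add: mult_ac)
    qed
    then show "(\<Sum>l\<le>m - 2 * k. f (l + k) k) = connection_coeff a b q m k * rogers_sum a q (m - 2 * k) z w"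
      unfolding rogers_sum_def sum_distrib_left by (intro sum.cong) auto
  qed
  finally show ?thesis .
qed

section \<open>Infinite products and the q-binomial theorem\<close>

lemma qpoch_convergent_prod:
  fixes a q :: complex
  assumes "norm q < 1"
  shows "convergent_prod (\<lambda>j. 1 - a * q ^ j)"
proof -
  have "summable (\<lambda>j. norm a * norm q ^ j)" using assms by (intro summable_mult summable_geometric) simp
  then have "summable (\<lambda>j. norm ((1 - a * q ^ j) - 1))" by (simp add: norm_mult norm_power)
  then have "abs_convergent_prod (\<lambda>j. 1 - a * q ^ j)" by (rule summable_imp_abs_convergent_prod)
  then show ?thesis by (rule abs_convergent_prod_imp_convergent_prod)
qed

lemma qpoch_LIMSEQ:
  assumes "norm q < 1"
  shows "qpoch a q \<longlonglongrightarrow> qpoch_inf a q"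
proof -
  have "(\<lambda>n. qpoch a q (Suc n)) \<longlonglongrightarrow> qpoch_inf a q"
    using convergent_prod_LIMSEQ[OF qpoch_convergent_prod[OF assms, of a]]
    by (simp add: qpoch_def qpoch_inf_def lessThan_Suc_atMost)
  then show ?thesis by (simp add: filterlim_sequentially_Suc)
qed

lemma qpoch_inf_split:
  assumes "norm q < 1"
  shows "qpoch_inf a q = qpoch a q n * qpoch_inf (a * q ^ n) q"
proof (rule LIMSEQ_unique)
  show "(\<lambda>m. qpoch a q (n + m)) \<longlonglongrightarrow> qpoch_inf a q"
    using LIMSEQ_ignore_initial_segment[OF qpoch_LIMSEQ[OF assms, of a], of n] by (simp add: add.commute)
  show "(\<lambda>m. qpoch a q (n + m)) \<longlonglongrightarrow> qpoch a q n * qpoch_inf (a * q ^ n) q"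
    unfolding qpoch_add by (intro tendsto_intros qpoch_LIMSEQ assms)
qed

lemma qpoch_inf_nonzero:
  assumes "norm a < 1" "norm q < 1"
  shows "qpoch_inf a q \<noteq> 0"
  unfolding qpoch_inf_def
  using qpoch_convergent_prod[OF assms(2)] one_minus_nonzero[OF assms] by (rule prodinf_nonzero)

lemma qpoch_quotient_bounded:
  assumes "norm b < 1" "norm q < 1"
  obtains M where "M > 0" "\<And>n. norm (qpoch a q n / qpoch b q n) \<le> M"
proof -
  have "(\<lambda>n. qpoch a q n / qpoch b q n) \<longlonglongrightarrow> qpoch_inf a q / qpoch_inf b q"
    using assms qpoch_inf_nonzero by (intro tendsto_divide qpoch_LIMSEQ) auto
  then have "Bseq (\<lambda>n. qpoch a q n / qpoch b q n)"
    using convergentI convergent_imp_Bseq by blast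
  then show thesis using that unfolding Bseq_def by blast
qed

lemma qpoch_bounded:
  assumes "norm q < 1"
  obtains M where "M > 0" "\<And>n. norm (qpoch a q n) \<le> M"
proof -
  have "qpoch 0 q n = 1" for n by (simp add: qpoch_def)
  then show thesis using qpoch_quotient_bounded[of 0 q a] assms that by auto
qed

lemma qbinom_coeff_bounded:
  assumes "norm q < 1"
  obtains M where "M > 0" "\<And>n. norm (qbinom_coeff a q n) \<le> M"
  using qpoch_quotient_bounded[OF assms assms, of a] that unfolding qbinom_coeff_def by blast

lemma summable_bounded_geometric:
  fixes c :: "nat \<Rightarrow> complex"
  assumes "\<And>n. norm (c n) \<le> M" "norm z < 1"
  shows "summable (\<lambda>k. norm (c k * z ^ k))"
proof (rule summable_comparison_test)
  show "\<exists>N. \<forall>n\<ge>N. norm (norm (c n * z ^ n)) \<le> M * norm z ^ n"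
    using assms by (auto simp: norm_mult norm_power intro!: mult_right_mono)
  show "summable (\<lambda>n. M * norm z ^ n)"
    using assms by (intro summable_mult summable_geometric) simp
qed

lemma qbinom_series_summable:
  assumes "norm q < 1" "norm z < 1"
  shows "summable (\<lambda>k. norm (qbinom_coeff a q k * z ^ k))"
  using qbinom_coeff_bounded[OF assms(1)] summable_bounded_geometric[OF _ assms(2)] by metis

text \<open>The sum \<open>h\<close> of the series satisfies \<open>(1 - z) h(z) = (1 - a z) h(q z)\<close> by the recurrence of its
  coefficients. Iterating pushes the argument to 0, where \<open>h\<close> is continuous with value 1.\<close>
theorem q_binomial:
  assumes q: "norm q < 1" and z: "norm z < 1"
  shows "(\<lambda>k. qbinom_coeff a q k * z ^ k) sums (qpoch_inf (a * z) q / qpoch_inf z q)"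
proof -
  let ?c = "qbinom_coeff a q"
  define h where "h z = (\<Sum>k. ?c k * z ^ k)" for z
  have summ: "summable (\<lambda>k. ?c k * z ^ k)" if "norm z < 1" for z
    using qbinom_series_summable[OF q that] by (rule summable_norm_cancel)
  have step: "(1 - z) * h z = (1 - a * z) * h (q * z)" if z: "norm z < 1" for z
  proof -
    have "norm q * norm z \<le> 1 * norm z" using q by (intro mult_right_mono) auto
    then have qz: "norm (q * z) < 1" using z by (simp add: norm_mult)
    note s1 = summ[OF z] and s2 = summ[OF qz]
    have "h z - h (q * z) = (\<Sum>k. ?c k * z ^ k - ?c k * (q * z) ^ k)"
      unfolding h_def by (rule suminf_diff[OF s1 s2])
    also have "\<dots> = (\<Sum>k. ?c (Suc k) * z ^ Suc k - ?c (Suc k) * (q * z) ^ Suc k)"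
      using suminf_split_head[OF summable_diff[OF s1 s2]] by simp
    also have "\<dots> = (\<Sum>k. z * (?c k * z ^ k) - a * z * (?c k * (q * z) ^ k))"
    proof (rule suminf_cong)
      fix k
      have "?c (Suc k) * z ^ Suc k - ?c (Suc k) * (q * z) ^ Suc k
          = ((1 - q * q ^ k) * ?c (Suc k)) * (z * z ^ k)"
        by (simp add: power_mult_distrib algebra_simps)
      then show "?c (Suc k) * z ^ Suc k - ?c (Suc k) * (q * z) ^ Suc k
          = z * (?c k * z ^ k) - a * z * (?c k * (q * z) ^ k)"
        unfolding qbinom_coeff_Suc[OF q] by (simp add: power_mult_distrib algebra_simps)
    qed
    also have "\<dots> = z * h z - a * z * h (q * z)"
      unfolding h_def using s1 s2
      by (subst suminf_diff[symmetric]) (auto intro!: summable_mult simp: suminf_mult)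
    finally show ?thesis by (simp add: algebra_simps)
  qed
  have iter: "qpoch z q n * h z = qpoch (a * z) q n * h (z * q ^ n)" for n
  proof (induction n)
    case (Suc n)
    have "norm z * norm q ^ n \<le> norm z * 1" using q by (intro mult_left_mono power_le_one) auto
    then have "norm (z * q ^ n) < 1" using z by (simp add: norm_mult norm_power)
    from step[OF this] have *: "(1 - z * q ^ n) * h (z * q ^ n) = (1 - a * z * q ^ n) * h (z * q ^ Suc n)"
      by (simp add: mult_ac)
    have "qpoch z q (Suc n) * h z = (1 - z * q ^ n) * (qpoch z q n * h z)"
      by (simp add: qpoch_Suc mult_ac)
    also have "\<dots> = qpoch (a * z) q n * ((1 - z * q ^ n) * h (z * q ^ n))"
      unfolding Suc by (simp only: mult_ac)
    finally show ?case unfolding * by (simp only: qpoch_Suc mult_ac)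
  qed simp
  have "isCont (\<lambda>x. \<Sum>k. ?c k * x ^ k) 0"
    by (rule isCont_powser[where K = "1/2"]) (use summ[of "1/2"] in simp_all)
  moreover have "(\<lambda>n. z * q ^ n) \<longlonglongrightarrow> z * 0"
    by (intro tendsto_intros LIMSEQ_power_zero q)
  ultimately have "(\<lambda>n. h (z * q ^ n)) \<longlonglongrightarrow> h 0"
    unfolding h_def by (intro isCont_tendsto_compose[where g = "\<lambda>x. \<Sum>k. ?c k * x ^ k"]) auto
  moreover have "h 0 = 1" unfolding h_def by (subst powser_zero) simp
  ultimately have "(\<lambda>n. qpoch (a * z) q n * h (z * q ^ n)) \<longlonglongrightarrow> qpoch_inf (a * z) q * 1"
    by (intro tendsto_intros qpoch_LIMSEQ q) auto
  moreover have "(\<lambda>n. qpoch z q n * h z) \<longlonglongrightarrow> qpoch_inf z q * h z"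
    by (intro tendsto_intros qpoch_LIMSEQ q)
  ultimately have "qpoch_inf z q * h z = qpoch_inf (a * z) q"
    unfolding iter using LIMSEQ_unique by fastforce
  then have "h z = qpoch_inf (a * z) q / qpoch_inf z q"
    using qpoch_inf_nonzero[OF z q] by (simp add: field_simps)
  then show ?thesis using summ[OF z] unfolding h_def by (simp add: sums_iff)
qed

section \<open>Fourier coefficients of the reduced weight\<close>

text \<open>Power series coefficients of \<open>h(y) = (q y;q)\<^sub>\<infinity> / (a y;q)\<^sub>\<infinity>\<close> and of
  \<open>(1 - y) h(y) = (y;q)\<^sub>\<infinity> / (a y;q)\<^sub>\<infinity>\<close>.\<close>
definition half_coeff :: "complex \<Rightarrow> complex \<Rightarrow> nat \<Rightarrow> complex" where
  "half_coeff a q k = qbinom_coeff (q / a) q k * a ^ k"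

definition half_coeff_diff :: "complex \<Rightarrow> complex \<Rightarrow> nat \<Rightarrow> complex" where
  "half_coeff_diff a q k = qbinom_coeff (1 / a) q k * a ^ k"

text \<open>\<open>half_coeff a q (k + j)\<close> without the factor \<open>(q/a;q)\<^sub>j a\<^sup>j\<close>, which does not depend on \<open>k\<close> and
  vanishes for large \<open>j\<close> if \<open>a\<close> is a power of \<open>q\<close>. Dividing it out keeps the limit \<open>j \<rightarrow> \<infinity>\<close>
  informative for such \<open>a\<close>.\<close>
definition diff_tail :: "complex \<Rightarrow> complex \<Rightarrow> nat \<Rightarrow> nat \<Rightarrow> complex" where
  "diff_tail a q j k = qpoch (q ^ Suc j / a) q k * a ^ k / qpoch q q (k + j)"

text \<open>The coefficient \<open>E\<^sub>j\<close> of \<open>y\<^sup>-\<^sup>j\<close> in \<open>(1 - y) h(y) h(1/y)\<close>, for \<open>j \<ge> 0\<close>.\<close>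
definition fourier_diff :: "complex \<Rightarrow> complex \<Rightarrow> nat \<Rightarrow> complex" where
  "fourier_diff a q j = (\<Sum>k. half_coeff_diff a q k * half_coeff a q (k + j))"

context
  fixes a q :: complex
  assumes q: "norm q < 1" and a0: "a \<noteq> 0" and a1: "norm a < 1"
begin

lemma half_coeff_summable: "summable (\<lambda>k. norm (half_coeff a q k))"
  unfolding half_coeff_def using q a1 by (rule qbinom_series_summable)

lemma half_coeff_diff_summable: "summable (\<lambda>k. norm (half_coeff_diff a q k))"
  unfolding half_coeff_diff_def using q a1 by (rule qbinom_series_summable)

lemma half_coeff_bounded: "\<exists>M>0. \<forall>k. norm (half_coeff a q k) \<le> M"
proof -
  have "Bseq (half_coeff a q)"
    using summable_LIMSEQ_zero[OF summable_norm_cancel[OF half_coeff_summable]]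
    by (meson convergentI convergent_imp_Bseq)
  then show ?thesis unfolding Bseq_def .
qed

lemma half_coeff_diff_Suc:
  "(1 - q * q ^ k) * half_coeff_diff a q (Suc k) = (a - q ^ k) * half_coeff_diff a q k"
proof -
  have "(1 - q * q ^ k) * half_coeff_diff a q (Suc k)
      = ((1 - q * q ^ k) * qbinom_coeff (1 / a) q (Suc k)) * (a * a ^ k)"
    by (simp add: half_coeff_diff_def)
  also have "\<dots> = (a - q ^ k) * half_coeff_diff a q k"
    unfolding qbinom_coeff_Suc[OF q] using a0 by (simp add: half_coeff_diff_def field_simps)
  finally show ?thesis .
qed

lemma half_coeff_diff_eq: "half_coeff_diff a q (Suc k) = half_coeff a q (Suc k) - half_coeff a q k"
proof -
  have "(1 - q * q ^ k) * (half_coeff a q (Suc k) - half_coeff a q k)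
      = ((1 - q * q ^ k) * qbinom_coeff (q / a) q (Suc k)) * (a * a ^ k) - (1 - q * q ^ k) * half_coeff a q k"
    by (simp add: half_coeff_def algebra_simps)
  also have "\<dots> = (a - 1) * half_coeff a q k"
    unfolding qbinom_coeff_Suc[OF q] using a0 by (simp add: half_coeff_def field_simps)
  also have "\<dots> = (1 - q * q ^ k) * half_coeff_diff a q (Suc k)"
    using a0 one_minus_power_nonzero[OF q, of k] qpoch_nonzero[OF q q, of k]
    unfolding half_coeff_def half_coeff_diff_def qbinom_coeff_def qpoch_Suc_left[of "1 / a"]
    by (simp add: qpoch_Suc[of q] divide_simps)
  finally show ?thesis using one_minus_power_nonzero[OF q, of k] by simp
qed

lemma half_coeff_add: "half_coeff a q (k + j) = qpoch (q / a) q j * a ^ j * diff_tail a q j k"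
  using qpoch_add[of "q / a" q j k]
  by (simp add: half_coeff_def qbinom_coeff_def diff_tail_def power_add add.commute mult_ac)

lemma diff_tail_bounded: "\<exists>M>0. \<forall>j k. norm (diff_tail a q j k) \<le> M"
proof -
  obtain M where M: "M > 0" "\<And>n. norm (qpoch (-1) (of_real (norm q)) n) \<le> M"
    using qpoch_bounded[of "of_real (norm q)"] q by auto
  obtain N where N: "N > 0" "\<And>n. norm (qpoch 0 q n / qpoch q q n) \<le> N"
    using qpoch_quotient_bounded[OF q q, of 0] by auto
  have "norm (diff_tail a q j k) \<le> M * N" for j k
  proof -
    have "qpoch (q ^ Suc j / a) q k * a ^ k = (\<Prod>i<k. (1 - q ^ Suc j / a * q ^ i) * a)"
      by (simp add: qpoch_def prod.distrib)
    also have "\<dots> = (\<Prod>i<k. a - q ^ Suc j * q ^ i)"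
      using a0 by (intro prod.cong) (auto simp: field_simps)
    also have "norm \<dots> \<le> (\<Prod>i<k. norm (1 + complex_of_real (norm q) ^ i))"
      unfolding prod_norm[symmetric]
    proof (intro prod_mono conjI)
      fix i
      have "norm (a - q ^ Suc j * q ^ i) \<le> norm a + norm (q ^ Suc j * q ^ i)" by (rule norm_triangle_ineq4)
      also have "norm (q ^ Suc j * q ^ i) = norm q ^ Suc j * norm q ^ i" by (simp add: norm_mult norm_power)
      also have "\<dots> \<le> 1 * norm q ^ i" using q by (intro mult_right_mono power_le_one) auto
      finally have "norm (a - q ^ Suc j * q ^ i) \<le> 1 + norm q ^ i" using a1 by simp
      also have "\<dots> = norm (complex_of_real (1 + norm q ^ i))" unfolding norm_of_real by simp
      finally show "norm (a - q ^ Suc j * q ^ i) \<le> norm (1 + complex_of_real (norm q) ^ i)" by simp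
    qed simp
    also have "\<dots> = norm (qpoch (-1) (of_real (norm q)) k)" by (simp add: qpoch_def prod_norm)
    also have "\<dots> \<le> M" by (rule M)
    finally have 1: "norm (qpoch (q ^ Suc j / a) q k * a ^ k) \<le> M" .
    have "qpoch 0 q n = 1" for n by (simp add: qpoch_def)
    then have 2: "norm (1 / qpoch q q (k + j)) \<le> N" using N(2)[of "k + j"] by simp
    have "norm (diff_tail a q j k) = norm (qpoch (q ^ Suc j / a) q k * a ^ k) * norm (1 / qpoch q q (k + j))"
      by (simp add: diff_tail_def norm_divide norm_mult)
    also have "\<dots> \<le> M * N" using 1 2 M by (intro mult_mono) auto
    finally show ?thesis .
  qed
  then show ?thesis using M N by (intro exI[of _ "M * N"]) simp
qed

lemma diff_tail_summable: "summable (\<lambda>k. norm (half_coeff_diff a q k * diff_tail a q j k))"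
proof -
  obtain M where M: "\<And>j k. norm (diff_tail a q j k) \<le> M" using diff_tail_bounded by auto
  show ?thesis
  proof (rule summable_comparison_test)
    show "\<exists>N. \<forall>k\<ge>N. norm (norm (half_coeff_diff a q k * diff_tail a q j k)) \<le> norm (half_coeff_diff a q k) * M"
      using M by (auto simp: norm_mult intro!: mult_left_mono)
    show "summable (\<lambda>k. norm (half_coeff_diff a q k) * M)"
      by (intro summable_mult2 half_coeff_diff_summable)
  qed
qed

lemma fourier_diff_tail:
  "fourier_diff a q j = qpoch (q / a) q j * a ^ j * (\<Sum>k. half_coeff_diff a q k * diff_tail a q j k)"
  unfolding fourier_diff_def half_coeff_add
  by (subst suminf_mult[symmetric]) (auto intro: summable_norm_cancel[OF diff_tail_summable] simp: mult_ac)

text \<open>A contiguous relation of the nonterminating \<open>q\<close>-Gauss series: the difference of both sides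
  telescopes in \<open>k\<close>, and the boundary term at infinity vanishes because the summands tend to 0.
  Both the two-term recurrence of the \<open>E\<^sub>j\<close> and the value of \<open>E\<^sub>0\<close> follow from it.\<close>
lemma diff_tail_sum_step:
  "(1 - a * q ^ Suc j) * (\<Sum>k. half_coeff_diff a q k * diff_tail a q (Suc j) k)
     = (\<Sum>k. half_coeff_diff a q k * diff_tail a q j k)"
proof -
  let ?d = "half_coeff_diff a q" and ?s = "q ^ Suc j"
  define y where "y = diff_tail a q (Suc j)"
  define G where "G k = (case k of 0 \<Rightarrow> 0 | Suc l \<Rightarrow> - ?s * (a - q ^ l) * ?d l * y l)" for k
  have summ1: "summable (\<lambda>k. ?d k * y k)" unfolding y_def by (rule summable_norm_cancel[OF diff_tail_summable])
  have summ2: "summable (\<lambda>k. ?d k * diff_tail a q j k)" by (rule summable_norm_cancel[OF diff_tail_summable])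
  have nz: "qpoch q q m \<noteq> 0" "1 - q * q ^ m \<noteq> 0" for m
    using qpoch_nonzero[OF q q] one_minus_power_nonzero[OF q] by auto
  have tele: "(1 - a * ?s) * (?d k * y k) - ?d k * diff_tail a q j k = G (Suc k) - G k" for k
  proof (cases k)
    case 0
    then show ?thesis using nz[of j]
      by (simp add: G_def y_def diff_tail_def qpoch_Suc half_coeff_diff_def divide_simps) (simp add: algebra_simps)
  next
    case (Suc l)
    define p where "p = qpoch (q ^ Suc (Suc j) / a) q l * a ^ l / qpoch q q (l + Suc j)"
    have yl: "y l = p" by (simp add: y_def p_def diff_tail_def)
    have factor: "(1 - q ^ Suc (Suc j) / a * q ^ l) * a = a - ?s * q ^ k" "(1 - ?s / a) * a = a - ?s"
      using a0 Suc by (simp_all add: field_simps)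
    have last: "1 - ?s * q ^ k = 1 - q * q ^ (l + Suc j)" using Suc by (simp add: power_add mult_ac)
    have "y k = ((1 - q ^ Suc (Suc j) / a * q ^ l) * a) * p / (1 - q * q ^ (l + Suc j))"
      unfolding y_def diff_tail_def p_def Suc add_Suc by (simp add: qpoch_Suc mult_ac)
    then have "y k = (a - ?s * q ^ k) * p / (1 - ?s * q ^ k)"
      unfolding factor last .
    then have yrec: "y k * (1 - ?s * q ^ k) = y l * (a - ?s * q ^ k)"
      using nz(2)[of "l + Suc j"] unfolding yl last by simp
    have "diff_tail a q j k = ((1 - ?s / a) * a) * p"
      unfolding diff_tail_def p_def Suc qpoch_Suc_left by (simp add: mult_ac)
    then have v: "diff_tail a q j k = (a - ?s) * y l"
      unfolding factor yl .
    have "G k = - ?s * ((1 - q * q ^ l) * ?d k) * y l"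
      unfolding Suc half_coeff_diff_Suc by (simp add: G_def mult_ac)
    then have "G (Suc k) - G k = ?d k * (- ?s * (a - q ^ k) * y k + ?s * (1 - q ^ k) * y l)"
      using Suc by (simp add: G_def algebra_simps)
    also have "- ?s * (a - q ^ k) * y k + ?s * (1 - q ^ k) * y l = (1 - a * ?s) * y k - (a - ?s) * y l"
      using yrec by (simp add: algebra_simps)
    finally show ?thesis unfolding v by (simp add: algebra_simps)
  qed
  have "(\<lambda>k. ?d k * y k) \<longlonglongrightarrow> 0" by (rule summable_LIMSEQ_zero[OF summ1])
  then have "(\<lambda>k. - ?s * (a - q ^ k) * (?d k * y k)) \<longlonglongrightarrow> - ?s * (a - 0) * 0"
    by (intro tendsto_intros LIMSEQ_power_zero q)
  then have "(\<lambda>k. G (Suc k)) \<longlonglongrightarrow> 0" by (simp add: G_def mult.assoc)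
  then have "G \<longlonglongrightarrow> 0" by (simp add: filterlim_sequentially_Suc)
  then have "(\<lambda>k. G (Suc k) - G k) sums (0 - G 0)" by (rule telescope_sums)
  then have "(\<Sum>k. (1 - a * ?s) * (?d k * y k) - ?d k * diff_tail a q j k) = 0"
    unfolding tele by (simp add: sums_iff G_def)
  then show ?thesis
    using suminf_diff[OF summable_mult[OF summ1] summ2, of "1 - a * ?s"] suminf_mult[OF summ1, of "1 - a * ?s"]
    unfolding y_def by simp
qed

lemma fourier_diff_Suc:
  "fourier_diff a q (Suc j) * (1 - a * q ^ Suc j) = fourier_diff a q j * (a - q ^ Suc j)"
proof -
  have "fourier_diff a q (Suc j) * (1 - a * q ^ Suc j)
      = qpoch (q / a) q (Suc j) * a ^ Suc j * (\<Sum>k. half_coeff_diff a q k * diff_tail a q j k)"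
    unfolding fourier_diff_tail[of "Suc j"] diff_tail_sum_step[of j, symmetric] by (simp only: mult_ac)
  also have "\<dots> = fourier_diff a q j * (a - q ^ Suc j)"
    unfolding fourier_diff_tail[of j] using a0 by (simp add: qpoch_Suc field_simps)
  finally show ?thesis .
qed

text \<open>Iterating the contiguous relation expresses \<open>E\<^sub>0\<close> through the tail sums at \<open>j\<close>. As \<open>j \<rightarrow> \<infinity>\<close>
  these converge, by dominated convergence, to a series summed by the \<open>q\<close>-binomial theorem.\<close>
lemma fourier_diff_0:
  "fourier_diff a q 0 = qpoch_inf a q * qpoch_inf (q * a) q / (qpoch_inf (a\<^sup>2) q * qpoch_inf q q)"
proof -
  let ?d = "half_coeff_diff a q"
  define U where "U j = (\<Sum>k. ?d k * diff_tail a q j k)" for j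
  have U0: "fourier_diff a q 0 = qpoch (q * a) q j * U j" for j
  proof (induction j)
    case 0
    then show ?case by (simp add: fourier_diff_tail U_def)
  next
    case (Suc j)
    then show ?case using diff_tail_sum_step[of j]
      unfolding U_def by (simp add: qpoch_Suc mult_ac)
  qed
  obtain M where M: "\<And>j k. norm (diff_tail a q j k) \<le> M" using diff_tail_bounded by auto
  have "U \<longlonglongrightarrow> (\<Sum>k. ?d k * (a ^ k / qpoch_inf q q))"
    unfolding U_def
  proof (rule conjunct2[OF conjunct2[OF tannerys_theorem[where a = "\<lambda>k j. ?d k * diff_tail a q j k"
          and b = "\<lambda>k. ?d k * (a ^ k / qpoch_inf q q)" and M = "\<lambda>k. norm (?d k) * M" and F = sequentially]]])
    show "summable (\<lambda>k. norm (?d k) * M)" by (intro summable_mult2 half_coeff_diff_summable)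
    show "\<forall>\<^sub>F (k, j) in sequentially \<times>\<^sub>F sequentially. norm (?d k * diff_tail a q j k) \<le> norm (?d k) * M"
      using M by (intro always_eventually) (auto simp: norm_mult intro!: mult_left_mono)
    fix k
    have "(\<lambda>j. q ^ Suc j) \<longlonglongrightarrow> 0"
      using LIMSEQ_power_zero[OF q] by (subst filterlim_sequentially_Suc)
    then have "(\<lambda>j. qpoch (q ^ Suc j / a) q k) \<longlonglongrightarrow> (\<Prod>i<k. 1 - 0 / a * q ^ i)"
      unfolding qpoch_def using a0 by (intro tendsto_intros)
    moreover have "(\<lambda>j. qpoch q q (k + j)) \<longlonglongrightarrow> qpoch_inf q q"
      using LIMSEQ_ignore_initial_segment[OF qpoch_LIMSEQ[OF q, of q], of k] by (simp add: add.commute)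
    ultimately have "(\<lambda>j. ?d k * (qpoch (q ^ Suc j / a) q k * a ^ k / qpoch q q (k + j)))
        \<longlonglongrightarrow> ?d k * ((\<Prod>i<k. 1 - 0 / a * q ^ i) * a ^ k / qpoch_inf q q)"
      using qpoch_inf_nonzero[OF q q] by (intro tendsto_intros)
    then show "(\<lambda>j. ?d k * diff_tail a q j k) \<longlonglongrightarrow> ?d k * (a ^ k / qpoch_inf q q)"
      by (simp add: diff_tail_def)
  qed simp
  then have "(\<lambda>j. qpoch (q * a) q j * U j) \<longlonglongrightarrow> qpoch_inf (q * a) q * (\<Sum>k. ?d k * (a ^ k / qpoch_inf q q))"
    by (intro tendsto_mult qpoch_LIMSEQ q)
  then have "fourier_diff a q 0 = qpoch_inf (q * a) q * (\<Sum>k. ?d k * (a ^ k / qpoch_inf q q))"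
    unfolding U0[symmetric] by (rule LIMSEQ_unique[OF tendsto_const])
  moreover have "(\<Sum>k. ?d k * (a ^ k / qpoch_inf q q)) = qpoch_inf a q / qpoch_inf (a\<^sup>2) q / qpoch_inf q q"
  proof -
    have "norm (a\<^sup>2) < 1" using a1 by (simp add: norm_power power_less_one_iff)
    from q_binomial[OF q this, of "1 / a"]
    have "(\<lambda>k. qbinom_coeff (1 / a) q k * (a\<^sup>2) ^ k) sums (qpoch_inf a q / qpoch_inf (a\<^sup>2) q)"
      using a0 by (simp add: power2_eq_square)
    from sums_divide[OF this, of "qpoch_inf q q"] show ?thesis
      by (simp add: sums_iff half_coeff_diff_def power2_eq_square power_mult_distrib mult_ac)
  qed
  ultimately show ?thesis by simp
qed

lemma half_coeff_prod_summable: "summable (\<lambda>k. norm (half_coeff a q k * half_coeff a q (k + j)))"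
proof -
  obtain M where M: "\<And>k. norm (half_coeff a q k) \<le> M" using half_coeff_bounded by auto
  show ?thesis
  proof (rule summable_comparison_test)
    show "\<exists>N. \<forall>k\<ge>N. norm (norm (half_coeff a q k * half_coeff a q (k + j))) \<le> norm (half_coeff a q k) * M"
      using M by (auto simp: norm_mult intro!: mult_left_mono)
    show "summable (\<lambda>k. norm (half_coeff a q k) * M)"
      by (intro summable_mult2 half_coeff_summable)
  qed
qed

text \<open>Summation by parts, since \<open>half_coeff_diff\<close> is the difference sequence of \<open>half_coeff\<close>. Written
  this way, \<open>E\<^sub>j\<close> continues to negative \<open>j\<close> with \<open>E\<^bsub>-j-1\<^esub> = - E\<^sub>j\<close>.\<close>
lemma fourier_diff_autocorrelation:
  "fourier_diff a q j = (\<Sum>k. half_coeff a q k * half_coeff a q (k + j))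
      - (\<Sum>k. half_coeff a q k * half_coeff a q (k + Suc j))"
proof -
  let ?b = "half_coeff a q" and ?d = "half_coeff_diff a q"
  note s = summable_norm_cancel[OF half_coeff_prod_summable]
  have d0: "?d 0 = ?b 0" by (simp add: half_coeff_def half_coeff_diff_def)
  have "(\<lambda>k. ?b (Suc k) * ?b (Suc k + j)) sums ((\<Sum>k. ?b k * ?b (k + j)) - ?b 0 * ?b j)"
    using s[of j] by (subst sums_Suc_iff) (simp add: summable_sums)
  moreover have "(\<lambda>k. ?b k * ?b (k + Suc j)) sums (\<Sum>k. ?b k * ?b (k + Suc j))"
    using s[of "Suc j"] by (rule summable_sums)
  ultimately have "(\<lambda>k. ?b (Suc k) * ?b (Suc k + j) - ?b k * ?b (k + Suc j)) sums
      ((\<Sum>k. ?b k * ?b (k + j)) - ?b 0 * ?b j - (\<Sum>k. ?b k * ?b (k + Suc j)))"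
    by (rule sums_diff)
  then have "(\<lambda>k. ?d (Suc k) * ?b (Suc k + j)) sums
      ((\<Sum>k. ?b k * ?b (k + j)) - ?b 0 * ?b j - (\<Sum>k. ?b k * ?b (k + Suc j)))"
    by (simp add: half_coeff_diff_eq algebra_simps)
  then show ?thesis
    unfolding fourier_diff_def using d0 by (subst (asm) sums_Suc_iff) (simp add: sums_iff algebra_simps)
qed

end

section \<open>Moments of the Rogers polynomials\<close>

text \<open>The Fourier coefficients \<open>E\<^sub>p\<close> for all integers \<open>p\<close>.\<close>
definition fourier_int :: "complex \<Rightarrow> complex \<Rightarrow> int \<Rightarrow> complex" where
  "fourier_int a q p = (if p \<ge> 0 then fourier_diff a q (nat p) else - fourier_diff a q (nat (- p - 1)))"

lemma fourier_int_reflect: "fourier_int a q (- p - 1) = - fourier_int a q p"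
  by (simp add: fourier_int_def)

lemma fourier_int_nat [simp]: "fourier_int a q (int k) = fourier_diff a q k"
  by (simp add: fourier_int_def)

context
  fixes a q :: complex
  assumes q: "norm q < 1" and a0: "a \<noteq> 0" and a1: "norm a < 1"
begin

text \<open>The two-term recurrence holds across the sign change. With \<open>u = q\<^sup>1\<^sup>-\<^sup>s\<close> the sequence
  \<open>k \<mapsto> E\<^bsub>k-s\<^esub>\<close> is therefore admissible in the Saalschuetz recurrence.\<close>
lemma fourier_int_shift:
  assumes q0: "q \<noteq> 0"
  shows "fourier_int a q (int (Suc k) - int s) * (1 - a * (q / q ^ s) * q ^ k)
       = fourier_int a q (int k - int s) * (a - q / q ^ s * q ^ k)"
proof (cases "s \<le> k")
  case True
  then obtain j where j: "k = s + j" using le_Suc_ex by blast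
  have u: "q / q ^ s * q ^ k = q ^ Suc j" using q0 by (simp add: j power_add)
  have i: "int (Suc k) - int s = int (Suc j)" "int k - int s = int j" using j by auto
  show ?thesis unfolding mult.assoc[of a] u i fourier_int_nat by (rule fourier_diff_Suc[OF q a0 a1])
next
  case False
  then obtain d where d: "s = Suc (k + d)" using less_imp_Suc_add by (metis not_le)
  have u: "q / q ^ s * q ^ k = 1 / q ^ d" using q0 by (simp add: d power_add)
  have i: "int k - int s = - int d - 1" "int (Suc k) - int s = - int d" using d by auto
  show ?thesis
  proof (cases d)
    case 0
    then show ?thesis unfolding mult.assoc[of a] u i fourier_int_reflect using fourier_int_nat[of a q 0]
      by (simp add: algebra_simps)
  next
    case (Suc e)
    have i': "- int d = - int e - 1" using Suc by simp
    have "fourier_diff a q e * (1 - a * (1 / q ^ d)) * q ^ d = fourier_diff a q e * (q ^ Suc e - a)"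
      using q0 Suc by (simp add: field_simps)
    also have "\<dots> = - (fourier_diff a q d * (1 - a * q ^ Suc e))"
      unfolding Suc fourier_diff_Suc[OF q a0 a1] by (simp add: algebra_simps)
    also have "\<dots> = fourier_diff a q d * (a - 1 / q ^ d) * q ^ d"
      using q0 Suc by (simp add: field_simps)
    finally have "fourier_diff a q e * (1 - a * (1 / q ^ d)) = fourier_diff a q d * (a - 1 / q ^ d)"
      using q0 by simp
    moreover have "fourier_int a q (int k - int s) = - fourier_diff a q d"
      unfolding i(1) fourier_int_reflect by simp
    moreover have "fourier_int a q (int (Suc k) - int s) = - fourier_diff a q e"
      unfolding i(2) i' fourier_int_reflect by simp
    ultimately show ?thesis unfolding mult.assoc[of a] u by simp
  qed
qed

lemma fourier_int_saalschuetz_step: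
  assumes q0: "q \<noteq> 0"
  shows "(1 - q * q ^ n) * (1 - a * (q / q ^ s) * q ^ n) *
           (\<Sum>k\<le>Suc n. qbinom_coeff a q k * qbinom_coeff a q (Suc n - k) * fourier_int a q (int k - int s))
       = (1 - a\<^sup>2 * q ^ n) * (1 - (q / q ^ s) * q ^ n) *
           (\<Sum>k\<le>n. qbinom_coeff a q k * qbinom_coeff a q (n - k) * fourier_int a q (int k - int s))"
  by (rule saalschuetz_step[OF q fourier_int_shift[OF q0]])

lemma rogers_moment_leading:
  assumes q0: "q \<noteq> 0"
  shows "(\<Sum>k\<le>n. qbinom_coeff a q k * qbinom_coeff a q (n - k) * fourier_int a q (int k))
       = fourier_diff a q 0 * qpoch (a\<^sup>2) q n / qpoch (q * a) q n"
proof (induction n)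
  case 0
  show ?case using fourier_int_nat[of a q 0] by simp
next
  case (Suc n)
  have "norm q * norm a \<le> 1 * norm a" using q by (intro mult_right_mono) auto
  then have qa: "norm (q * a) < 1" using a1 by (simp add: norm_mult)
  define S where "S n = (\<Sum>k\<le>n. qbinom_coeff a q k * qbinom_coeff a q (n - k) * fourier_int a q (int k))" for n
  have "(1 - q * q ^ n) * ((1 - q * a * q ^ n) * S (Suc n)) = (1 - q * q ^ n) * ((1 - a\<^sup>2 * q ^ n) * S n)"
    using fourier_int_saalschuetz_step[OF q0, of n 0] unfolding S_def by (simp add: mult_ac)
  then have "(1 - q * a * q ^ n) * S (Suc n) = (1 - a\<^sup>2 * q ^ n) * S n"
    using one_minus_power_nonzero[OF q, of n] by simp
  also have "\<dots> = (1 - a\<^sup>2 * q ^ n) * (fourier_diff a q 0 * qpoch (a\<^sup>2) q n / qpoch (q * a) q n)"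
    using Suc by (simp add: S_def)
  finally have "S (Suc n) = (1 - a\<^sup>2 * q ^ n) * (fourier_diff a q 0 * qpoch (a\<^sup>2) q n / qpoch (q * a) q n)
      / (1 - q * a * q ^ n)"
    using one_minus_nonzero[OF qa q, of n] by (simp only: eq_divide_eq mult.commute) simp
  then show ?case
    unfolding S_def[symmetric] by (simp add: qpoch_Suc mult_ac)
qed

text \<open>At \<open>n = s - 1\<close> the factor \<open>1 - u q\<^sup>n\<close> of the Saalschuetz recurrence is 0, so the sum vanishes
  for \<open>n = s\<close> and then for all larger \<open>n\<close>. From \<open>n = s - 1\<close> on, the leading factors \<open>1 - a u q\<^sup>n\<close>
  are \<open>1 - a q\<^sup>j\<close> with \<open>j \<ge> 0\<close> and cannot vanish; for smaller \<open>n\<close> they may.\<close>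
lemma rogers_moment_vanish:
  assumes q0: "q \<noteq> 0" and s: "1 \<le> s" "s \<le> n"
  shows "(\<Sum>k\<le>n. qbinom_coeff a q k * qbinom_coeff a q (n - k) * fourier_int a q (int k - int s)) = 0"
  using s(2)
proof (induction n rule: dec_induct)
  case base
  obtain m where m: "s = Suc m" using s(1) by (cases s) auto
  have u: "q / q ^ s * q ^ m = 1" using q0 by (simp add: m)
  have "(1 - q * q ^ m) * (1 - a) *
     (\<Sum>k\<le>s. qbinom_coeff a q k * qbinom_coeff a q (s - k) * fourier_int a q (int k - int s)) = 0"
    using fourier_int_saalschuetz_step[OF q0, of m s] unfolding mult.assoc[of a] u m[symmetric] by simp
  moreover have "a \<noteq> 1" using a1 by auto
  ultimately show ?case using one_minus_power_nonzero[OF q, of m] by simp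
next
  case (step n)
  then obtain j where j: "n = s + j" using le_Suc_ex by blast
  have u: "q / q ^ s * q ^ n = q ^ Suc j" using q0 by (simp add: j power_add)
  have "(1 - q * q ^ n) * (1 - a * q ^ Suc j) *
     (\<Sum>k\<le>Suc n. qbinom_coeff a q k * qbinom_coeff a q (Suc n - k) * fourier_int a q (int k - int s)) = 0"
    using fourier_int_saalschuetz_step[OF q0, of n s] step.IH unfolding mult.assoc[of a] u by simp
  then show ?case
    using one_minus_power_nonzero[OF q, of n] one_minus_nonzero[OF a1 q, of "Suc j"] by simp
qed

end

section \<open>Integrals against the weight\<close>

lemma cis_integral:
  "((\<lambda>\<theta>. cis (of_int j * \<theta>)) has_integral (if j = 0 then of_real (2 * pi) else 0)) {- pi..pi}"
proof (cases "j = 0")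
  case True
  then show ?thesis using has_integral_const_real[of "1::complex" "- pi" pi] by (simp add: scaleR_conv_of_real)
next
  case False
  define F where "F \<theta> = cis (of_int j * \<theta>) / (\<i> * of_int j)" for \<theta>
  have "(F has_vector_derivative cis (of_int j * \<theta>)) (at \<theta> within {- pi..pi})" for \<theta>
  proof -
    have "((\<lambda>z. exp (\<i> * of_int j * z) / (\<i> * of_int j)) has_field_derivative exp (\<i> * of_int j * of_real \<theta>)) (at (of_real \<theta>))"
      using False by (auto intro!: derivative_eq_intros)
    from has_vector_derivative_real_field[OF this]
    show ?thesis unfolding F_def cis_conv_exp by (simp add: mult_ac)
  qed
  then have "((\<lambda>\<theta>. cis (of_int j * \<theta>)) has_integral (F pi - F (- pi))) {- pi..pi}"
    by (intro fundamental_theorem_of_calculus) auto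
  moreover have "cis (of_int j * pi) = cis (of_int j * - pi)"
    by (simp add: complex_eq_iff sin_int_times_real sin_zero_iff_int2)
  ultimately show ?thesis using False by (simp add: F_def)
qed

text \<open>Term-by-term integration under a Weierstrass majorant.\<close>
lemma integral_uniform_sums:
  fixes u :: "nat \<Rightarrow> real \<Rightarrow> complex"
  assumes cont: "\<And>k. continuous_on {c..d} (u k)"
    and bound: "\<And>k x. x \<in> {c..d} \<Longrightarrow> norm (u k x) \<le> M k" and M: "summable M"
  shows "(\<lambda>k. integral {c..d} (u k)) sums integral {c..d} (\<lambda>x. \<Sum>k. u k x)"
    and "continuous_on {c..d} (\<lambda>x. \<Sum>k. u k x)"
proof -
  have lim: "uniform_limit {c..d} (\<lambda>n x. \<Sum>k<n. u k x) (\<lambda>x. \<Sum>k. u k x) sequentially"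
    by (rule Weierstrass_m_test[OF bound M])
  have cont': "continuous_on {c..d} (\<lambda>x. \<Sum>k<n. u k x)" for n
    by (intro continuous_on_sum cont)
  show "continuous_on {c..d} (\<lambda>x. \<Sum>k. u k x)"
    by (rule uniform_limit_theorem[OF _ lim]) (simp_all add: cont')
  obtain I J where I: "\<And>n. ((\<lambda>x. \<Sum>k<n. u k x) has_integral I n) {c..d}"
    and J: "((\<lambda>x. \<Sum>k. u k x) has_integral J) {c..d}" and "I \<longlonglongrightarrow> J"
    by (rule uniform_limit_integral[OF lim cont']) auto
  have "I n = (\<Sum>k<n. integral {c..d} (u k))" for n
    using I[of n] integral_sum[of "{..<n}" u "{c..d}"] integrable_continuous_interval[OF cont]
    by (simp add: integral_unique)
  moreover have "J = integral {c..d} (\<lambda>x. \<Sum>k. u k x)" using J by (simp add: integral_unique)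
  ultimately show "(\<lambda>k. integral {c..d} (u k)) sums integral {c..d} (\<lambda>x. \<Sum>k. u k x)"
    using \<open>I \<longlonglongrightarrow> J\<close> unfolding sums_def by presburger
qed

definition half_series :: "complex \<Rightarrow> complex \<Rightarrow> complex \<Rightarrow> complex" where
  "half_series a q y = (\<Sum>k. half_coeff a q k * y ^ k)"

definition autocorrelation :: "complex \<Rightarrow> complex \<Rightarrow> int \<Rightarrow> complex" where
  "autocorrelation a q p = (\<Sum>k. half_coeff a q k * half_coeff a q (k + nat \<bar>p\<bar>))"

text \<open>The weight at \<open>x = cos \<theta>\<close> as a function on the circle. For complex \<open>a\<close> and \<open>q\<close> this is the
  analytic expression; for real ones it is the squared modulus in the definition of the weight.\<close>
definition circle_weight :: "complex \<Rightarrow> complex \<Rightarrow> real \<Rightarrow> complex" where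
  "circle_weight a q \<theta> = (1 - cis (2 * \<theta>)) * (1 - cis (- 2 * \<theta>))
     * (half_series a q (cis (2 * \<theta>)) * half_series a q (cis (- 2 * \<theta>)))"

context
  fixes a q :: complex
  assumes q: "norm q < 1" and a0: "a \<noteq> 0" and a1: "norm a < 1"
begin

lemma half_series_eq:
  assumes "norm y \<le> 1"
  shows "half_series a q y = qpoch_inf (q * y) q / qpoch_inf (a * y) q"
proof -
  have "norm a * norm y \<le> norm a * 1" using assms by (intro mult_left_mono) auto
  then have "norm (a * y) < 1" using a1 by (simp add: norm_mult)
  from q_binomial[OF q this, of "q / a"] show ?thesis
    using a0 by (simp add: half_series_def half_coeff_def sums_iff power_mult_distrib mult_ac)
qed

lemma half_series_continuous:
  assumes "continuous_on UNIV y" "\<And>\<theta>. norm (y \<theta>) \<le> 1"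
  shows "continuous_on {- pi..pi} (\<lambda>\<theta>. half_series a q (y \<theta>))"
  unfolding half_series_def
proof (rule integral_uniform_sums(2))
  show "summable (\<lambda>k. norm (half_coeff a q k))" by (rule half_coeff_summable[OF q a0 a1])
  show "continuous_on {- pi..pi} (\<lambda>\<theta>. half_coeff a q k * y \<theta> ^ k)" for k
    using assms(1) by (intro continuous_intros) (auto intro: continuous_on_subset)
  show "norm (half_coeff a q k * y \<theta> ^ k) \<le> norm (half_coeff a q k)" for k \<theta>
    using assms(2)[of \<theta>] by (simp add: norm_mult norm_power mult_left_le power_le_one)
qed

lemma half_series_cis_continuous [continuous_intros]:
  "continuous_on {- pi..pi} (\<lambda>\<theta>. half_series a q (cis (2 * \<theta>)))"
  "continuous_on {- pi..pi} (\<lambda>\<theta>. half_series a q (cis (- 2 * \<theta>)))"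
  by (intro half_series_continuous continuous_intros; simp)+

lemma half_series_moment:
  "integral {- pi..pi} (\<lambda>\<theta>. cis (of_int j * \<theta>) * half_series a q (cis (- 2 * \<theta>)))
   = (if j \<ge> 0 \<and> even j then 2 * pi * half_coeff a q (nat (j div 2)) else 0)"
proof -
  let ?b = "half_coeff a q"
  define u where "u k \<theta> = ?b k * cis (of_int (j - 2 * int k) * \<theta>)" for k \<theta>
  have eq: "cis (of_int j * \<theta>) * half_series a q (cis (- 2 * \<theta>)) = (\<Sum>k. u k \<theta>)" for \<theta>
  proof -
    have s: "summable (\<lambda>k. ?b k * cis (- 2 * \<theta>) ^ k)"
      by (rule summable_norm_cancel) (simp add: norm_mult norm_power half_coeff_summable[OF q a0 a1])
    have "u k \<theta> = cis (of_int j * \<theta>) * (?b k * cis (- 2 * \<theta>) ^ k)" for k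
      unfolding u_def Complex.DeMoivre by (simp add: cis_mult algebra_simps)
    then show ?thesis unfolding half_series_def using suminf_mult[OF s] by simp
  qed
  have int: "integral {- pi..pi} (u k) = (if j = 2 * int k then 2 * pi * ?b k else 0)" for k
    unfolding u_def using cis_integral[of "j - 2 * int k"]
    by (simp add: integral_unique mult_ac)
  have "(\<lambda>k. integral {- pi..pi} (u k)) sums integral {- pi..pi} (\<lambda>\<theta>. \<Sum>k. u k \<theta>)"
  proof (rule integral_uniform_sums)
    show "summable (\<lambda>k. norm (?b k))" by (rule half_coeff_summable[OF q a0 a1])
  qed (auto simp: u_def norm_mult intro!: continuous_intros)
  then have 1: "integral {- pi..pi} (\<lambda>\<theta>. cis (of_int j * \<theta>) * half_series a q (cis (- 2 * \<theta>)))
      = (\<Sum>k. if j = 2 * int k then 2 * pi * ?b k else 0)"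
    unfolding eq int by (simp add: sums_iff)
  show ?thesis
  proof (cases "j \<ge> 0 \<and> even j")
    case True
    then have "(if j = 2 * int k then 2 * pi * ?b k else 0) = (if k = nat (j div 2) then 2 * pi * ?b k else 0)" for k
      by auto
    then show ?thesis unfolding 1 using True sums_single[of "nat (j div 2)" "\<lambda>k. 2 * pi * ?b k"]
      by (simp add: sums_iff)
  next
    case False
    then have "j \<noteq> 2 * int k" for k by auto
    then show ?thesis unfolding 1 by (simp add: if_not_P[OF False])
  qed
qed

lemma half_series_square_moment:
  "integral {- pi..pi} (\<lambda>\<theta>. cis (of_int j * \<theta>) * (half_series a q (cis (2 * \<theta>)) * half_series a q (cis (- 2 * \<theta>))))
   = (if even j then 2 * pi * autocorrelation a q (j div 2) else 0)"
proof -
  let ?b = "half_coeff a q" and ?h = "\<lambda>\<theta>. half_series a q (cis (- 2 * \<theta>))"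
  define u where "u k \<theta> = ?b k * (cis (of_int (j + 2 * int k) * \<theta>) * ?h \<theta>)" for k \<theta>
  have eq: "cis (of_int j * \<theta>) * (half_series a q (cis (2 * \<theta>)) * ?h \<theta>) = (\<Sum>k. u k \<theta>)" for \<theta>
  proof -
    have s: "summable (\<lambda>k. ?b k * cis (2 * \<theta>) ^ k)"
      by (rule summable_norm_cancel) (simp add: norm_mult norm_power half_coeff_summable[OF q a0 a1])
    have "u k \<theta> = cis (of_int j * \<theta>) * ?h \<theta> * (?b k * cis (2 * \<theta>) ^ k)" for k
    proof -
      have "cis (of_int (j + 2 * int k) * \<theta>) = cis (of_int j * \<theta>) * cis (2 * \<theta>) ^ k"
        unfolding Complex.DeMoivre by (simp add: cis_mult algebra_simps)
      then show ?thesis unfolding u_def by (simp only: mult_ac)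
    qed
    then show ?thesis unfolding half_series_def[of a q "cis (2 * \<theta>)"] using suminf_mult[OF s, of "cis (of_int j * \<theta>) * ?h \<theta>"]
      by (simp add: mult_ac)
  qed
  have "compact (?h ` {- pi..pi})"
    by (intro compact_continuous_image continuous_intros) simp
  then have "bounded (?h ` {- pi..pi})" by (rule compact_imp_bounded)
  then obtain B where B: "norm (?h \<theta>) \<le> B" if "\<theta> \<in> {- pi..pi}" for \<theta>
    unfolding bounded_iff by blast
  have sums: "(\<lambda>k. integral {- pi..pi} (u k)) sums integral {- pi..pi} (\<lambda>\<theta>. \<Sum>k. u k \<theta>)"
  proof (rule integral_uniform_sums)
    show "summable (\<lambda>k. norm (?b k) * B)" by (intro summable_mult2 half_coeff_summable[OF q a0 a1])
    show "continuous_on {- pi..pi} (u k)" for k unfolding u_def by (intro continuous_intros)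
    show "norm (u k \<theta>) \<le> norm (?b k) * B" if "\<theta> \<in> {- pi..pi}" for k \<theta>
      using B[OF that] by (simp add: u_def norm_mult mult_left_mono)
  qed
  have int: "integral {- pi..pi} (u k)
      = ?b k * (if j + 2 * int k \<ge> 0 \<and> even j then 2 * pi * ?b (nat ((j + 2 * int k) div 2)) else 0)" for k
    unfolding u_def using half_series_moment[of "j + 2 * int k"] by simp
  show ?thesis
  proof (cases "even j")
    case False
    then show ?thesis using sums unfolding eq int by (simp add: sums_iff)
  next
    case True
    then obtain p where p: "j = 2 * p" by blast
    have A: "(\<lambda>k. 2 * pi * (?b k * ?b (k + nat \<bar>p\<bar>))) sums (2 * pi * autocorrelation a q p)"
      unfolding autocorrelation_def
      by (intro sums_mult summable_sums summable_norm_cancel[OF half_coeff_prod_summable[OF q a0 a1]])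
    have "(\<lambda>k. integral {- pi..pi} (u k)) sums (2 * pi * autocorrelation a q p)"
    proof (cases "p \<ge> 0")
      case True
      then have "nat ((j + 2 * int k) div 2) = k + nat \<bar>p\<bar>" for k using p by auto
      then show ?thesis unfolding int using A True p by (simp add: mult_ac)
    next
      case False
      define d where "d = nat \<bar>p\<bar>"
      have d: "p = - int d" using False by (simp add: d_def)
      have "(\<lambda>k. integral {- pi..pi} (u (k + d))) sums (2 * pi * autocorrelation a q p)"
        using A unfolding int p d by (simp add: mult_ac)
      moreover have "strict_mono (\<lambda>k. k + d)" by (simp add: strict_mono_def)
      moreover have "integral {- pi..pi} (u k) = 0" if "k \<notin> range (\<lambda>k. k + d)" for k
      proof -
        have "k < d" using that by (metis le_add_diff_inverse2 not_le rangeI)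
        then show ?thesis unfolding int p d by simp
      qed
      ultimately show ?thesis using sums_mono_reindex[of "\<lambda>k. k + d" "\<lambda>k. integral {- pi..pi} (u k)"] by blast
    qed
    then show ?thesis using sums True p unfolding eq by (simp add: sums_iff)
  qed
qed

lemma fourier_int_autocorrelation:
  "fourier_int a q p = autocorrelation a q p - autocorrelation a q (p + 1)"
proof (cases "p \<ge> 0")
  case True
  then have "nat \<bar>p + 1\<bar> = Suc (nat p)" "nat \<bar>p\<bar> = nat p" by auto
  then show ?thesis using True fourier_diff_autocorrelation[OF q a0 a1, of "nat p"]
    by (simp add: fourier_int_def autocorrelation_def)
next
  case False
  then have "nat \<bar>p + 1\<bar> = nat (- p - 1)" "nat \<bar>p\<bar> = Suc (nat (- p - 1))" by auto
  then show ?thesis using False fourier_diff_autocorrelation[OF q a0 a1, of "nat (- p - 1)"]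
    by (simp add: fourier_int_def autocorrelation_def)
qed

lemma circle_weight_continuous [continuous_intros]: "continuous_on {- pi..pi} (circle_weight a q)"
  unfolding circle_weight_def by (intro continuous_intros)

lemma circle_weight_moment:
  "integral {- pi..pi} (\<lambda>\<theta>. cis (of_int j * \<theta>) * circle_weight a q \<theta>)
   = (if even j then 2 * pi * (fourier_int a q (j div 2) - fourier_int a q (j div 2 - 1)) else 0)"
proof -
  define h where "h \<theta> = half_series a q (cis (2 * \<theta>)) * half_series a q (cis (- 2 * \<theta>))" for \<theta>
  have cont: "(\<lambda>\<theta>. cis (of_int i * \<theta>) * h \<theta>) integrable_on {- pi..pi}" for i
    unfolding h_def by (intro integrable_continuous_interval continuous_intros)
  have "cis (of_int j * \<theta>) * circle_weight a q \<theta> = 2 * (cis (of_int j * \<theta>) * h \<theta>)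
      - cis (of_int (j + 2) * \<theta>) * h \<theta> - cis (of_int (j - 2) * \<theta>) * h \<theta>" for \<theta>
  proof -
    have "cis (of_int (j + 2) * \<theta>) = cis (of_int j * \<theta>) * cis (2 * \<theta>)"
      "cis (of_int (j - 2) * \<theta>) = cis (of_int j * \<theta>) * cis (- 2 * \<theta>)"
      by (simp_all add: cis_mult algebra_simps)
    moreover have "cis (2 * \<theta>) * cis (- 2 * \<theta>) = 1" by (simp add: cis_mult)
    ultimately show ?thesis unfolding circle_weight_def h_def[symmetric] by (simp add: algebra_simps)
  qed
  then have "integral {- pi..pi} (\<lambda>\<theta>. cis (of_int j * \<theta>) * circle_weight a q \<theta>)
     = 2 * integral {- pi..pi} (\<lambda>\<theta>. cis (of_int j * \<theta>) * h \<theta>)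
      - integral {- pi..pi} (\<lambda>\<theta>. cis (of_int (j + 2) * \<theta>) * h \<theta>)
      - integral {- pi..pi} (\<lambda>\<theta>. cis (of_int (j - 2) * \<theta>) * h \<theta>)"
    using cont[of j] cont[of "j + 2"] cont[of "j - 2"]
    by (simp add: integral_diff integrable_diff)
  then show ?thesis
    unfolding h_def half_series_square_moment
    by (auto simp: fourier_int_autocorrelation algebra_simps elim!: evenE)
qed

end

lemma rogers_sum_circle:
  "rogers_sum a q m (cis \<theta>) (cis (- \<theta>))
   = (\<Sum>k\<le>m. qbinom_coeff a q k * qbinom_coeff a q (m - k) * cis (of_int (int m - 2 * int k) * \<theta>))"
  unfolding rogers_sum_def
proof (rule sum.cong)
  fix k assume "k \<in> {..m}"
  then have "cis \<theta> ^ (m - k) * cis (- \<theta>) ^ k = cis (of_int (int m - 2 * int k) * \<theta>)"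
    unfolding Complex.DeMoivre by (simp add: cis_mult of_nat_diff algebra_simps)
  then show "qbinom_coeff a q k * qbinom_coeff a q (m - k) * cis \<theta> ^ (m - k) * cis (- \<theta>) ^ k
      = qbinom_coeff a q k * qbinom_coeff a q (m - k) * cis (of_int (int m - 2 * int k) * \<theta>)"
    by (simp only: mult.assoc)
qed simp

lemma rogers_sum_swap: "rogers_sum a q m w z = rogers_sum a q m z w"
  unfolding rogers_sum_def
  by (rule sum.reindex_bij_witness[of _ "\<lambda>k. m - k" "\<lambda>k. m - k"]) (auto simp: mult_ac)

lemma rogers_sum_continuous [continuous_intros]:
  "continuous_on S (\<lambda>\<theta>. rogers_sum a q m (cis \<theta>) (cis (- \<theta>)))"
  unfolding rogers_sum_def by (intro continuous_intros)

lemma integral_even: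
  fixes f :: "real \<Rightarrow> complex"
  assumes "continuous_on {- c..c} f" "\<And>x. f (- x) = f x" "0 \<le> c"
  shows "integral {0..c} f = integral {- c..c} f / 2"
proof -
  have "integral {- c..0} f + integral {0..c} f = integral {- c..c} f"
    using assms by (intro Henstock_Kurzweil_Integration.integral_combine integrable_continuous_interval) auto
  moreover have "integral {- c..0} f = integral {0..c} f"
    using Henstock_Kurzweil_Integration.integral_reflect_real[of c 0 f] assms(2) by simp
  ultimately show ?thesis by (simp add: mult.commute)
qed

text \<open>Reversing both summation indices turns \<open>E\<^bsub>p-1\<^esub>\<close> into \<open>- E\<^sub>p\<close>, so the two halves of the moment
  agree. In what remains, each inner sum is a moment with shift \<open>s = (n - m)/2 + i\<close>, and since
  \<open>m \<le> n\<close> it vanishes unless \<open>s = 0\<close>, that is \<open>m = n\<close> and \<open>i = 0\<close>.\<close>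
lemma rogers_double_sum:
  assumes q: "norm q < 1" and q0: "q \<noteq> 0" and a0: "a \<noteq> 0" and a1: "norm a < 1"
    and N: "m + n = 2 * N" and mn: "m \<le> n"
  shows "(\<Sum>i\<le>m. \<Sum>k\<le>n. qbinom_coeff a q i * qbinom_coeff a q (m - i) * (qbinom_coeff a q k * qbinom_coeff a q (n - k))
            * (fourier_int a q (int N - int i - int k) - fourier_int a q (int N - int i - int k - 1)))
       = (if m = n then 2 * qbinom_coeff a q n * fourier_diff a q 0 * qpoch (a\<^sup>2) q n / qpoch (q * a) q n else 0)"
proof -
  let ?c = "qbinom_coeff a q"
  define f where "f m i = ?c i * ?c (m - i)" for m i
  define E where "E i k = fourier_int a q (int N - int i - int k)" for i k
  have reflect: "(\<Sum>i\<le>n. g i) = (\<Sum>i\<le>n. g (n - i))" for g :: "nat \<Rightarrow> complex" and n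
    by (rule sum.reindex_bij_witness[of _ "\<lambda>k. n - k" "\<lambda>k. n - k"]) auto
  have fsym: "f n (n - k) = f n k" if "k \<le> n" for n k using that by (simp add: f_def mult.commute)
  have "(\<Sum>i\<le>m. \<Sum>k\<le>n. f m i * f n k * fourier_int a q (int N - int i - int k - 1))
      = (\<Sum>i\<le>m. \<Sum>k\<le>n. f m (m - i) * f n (n - k) * fourier_int a q (int N - int (m - i) - int (n - k) - 1))"
    by (subst reflect) (rule sum.cong[OF refl], rule reflect)
  also have "\<dots> = (\<Sum>i\<le>m. \<Sum>k\<le>n. f m i * f n k * (- E i k))"
  proof (intro sum.cong refl)
    fix i k assume ik: "i \<in> {..m}" "k \<in> {..n}"
    have "int N - int (m - i) - int (n - k) - 1 = - (int N - int i - int k) - 1"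
      using ik N by auto
    moreover have "int N - int (m - (m - i)) - int (n - (n - k)) = int N - int i - int k" using ik by simp
    ultimately have "fourier_int a q (int N - int (m - i) - int (n - k) - 1) = - E i k"
      unfolding E_def by (simp only: fourier_int_reflect)
    then show "f m (m - i) * f n (n - k) * fourier_int a q (int N - int (m - i) - int (n - k) - 1)
        = f m i * f n k * - E i k"
      using fsym ik by simp
  qed
  finally have "(\<Sum>i\<le>m. \<Sum>k\<le>n. f m i * f n k * (E i k - fourier_int a q (int N - int i - int k - 1)))
      = 2 * (\<Sum>i\<le>m. f m i * (\<Sum>k\<le>n. f n k * E i k))"
    by (simp add: right_diff_distrib sum_subtractf sum_negf sum_distrib_left mult.assoc)
  also have "(\<Sum>i\<le>m. f m i * (\<Sum>k\<le>n. f n k * E i k))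
      = (\<Sum>i\<le>m. if i = 0 \<and> m = n then ?c n * (fourier_diff a q 0 * qpoch (a\<^sup>2) q n / qpoch (q * a) q n) else 0)"
  proof (intro sum.cong refl)
    fix i assume i: "i \<in> {..m}"
    define s where "s = n + i - N"
    have "(\<Sum>k\<le>n. f n k * E i k) = (\<Sum>k\<le>n. f n k * fourier_int a q (int k - int s))"
    proof (subst reflect, intro sum.cong refl)
      fix k assume k: "k \<in> {..n}"
      have "int N - int i - int (n - k) = int k - int s" using k mn N unfolding s_def by auto
      then have "E i (n - k) = fourier_int a q (int k - int s)" unfolding E_def by (simp only:)
      moreover have "f n (n - k) = f n k" using fsym k by simp
      ultimately show "f n (n - k) * E i (n - k) = f n k * fourier_int a q (int k - int s)"
        by (simp only:)
    qed
    also have "\<dots> = (if i = 0 \<and> m = n then fourier_diff a q 0 * qpoch (a\<^sup>2) q n / qpoch (q * a) q n else 0)"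
    proof (cases "i = 0 \<and> m = n")
      case True
      then have "s = 0" using N by (simp add: s_def)
      then show ?thesis using True rogers_moment_leading[OF q a0 a1 q0, of n] by (simp add: f_def)
    next
      case False
      then have "1 \<le> s" "s \<le> n" using mn N i unfolding s_def by auto
      then show ?thesis using rogers_moment_vanish[OF q a0 a1 q0, of s n]
        by (simp add: f_def if_not_P[OF False])
    qed
    finally show "f m i * (\<Sum>k\<le>n. f n k * E i k)
        = (if i = 0 \<and> m = n then ?c n * (fourier_diff a q 0 * qpoch (a\<^sup>2) q n / qpoch (q * a) q n) else 0)"
      by (auto simp: f_def)
  qed
  also have "\<dots> = (if m = n then ?c n * (fourier_diff a q 0 * qpoch (a\<^sup>2) q n / qpoch (q * a) q n) else 0)"
    by (cases "m = n") (simp_all add: sum.delta)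
  finally show ?thesis unfolding E_def f_def by simp
qed

text \<open>The squared norm of \<open>C\<^sub>n\<close> with respect to the weight on \<open>0 \<le> \<theta> \<le> \<pi>\<close>.\<close>
definition rogers_norm :: "complex \<Rightarrow> complex \<Rightarrow> nat \<Rightarrow> complex" where
  "rogers_norm a q n = 2 * pi * (qbinom_coeff a q n * fourier_diff a q 0 * qpoch (a\<^sup>2) q n / qpoch (q * a) q n)"

lemma rogers_orthogonal_le:
  assumes q: "norm q < 1" and q0: "q \<noteq> 0" and a0: "a \<noteq> 0" and a1: "norm a < 1" and mn: "m \<le> n"
  shows "integral {0..pi} (\<lambda>\<theta>. rogers_sum a q m (cis \<theta>) (cis (- \<theta>)) * (rogers_sum a q n (cis \<theta>) (cis (- \<theta>)) * circle_weight a q \<theta>))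
       = (if m = n then rogers_norm a q n else 0)"
proof -
  let ?c = "qbinom_coeff a q" and ?W = "circle_weight a q"
  let ?R = "\<lambda>m \<theta>. rogers_sum a q m (cis \<theta>) (cis (- \<theta>))"
  let ?f = "\<lambda>m i. ?c i * ?c (m - i)"
  note cW = circle_weight_continuous[OF q a0 a1]
  define G where "G i k \<theta> = ?f m i * ?f n k * (cis (of_int (int (m + n) - 2 * (int i + int k)) * \<theta>) * ?W \<theta>)" for i k \<theta>
  have int: "G i k integrable_on {- pi..pi}" for i k
    unfolding G_def by (intro integrable_continuous_interval continuous_intros cW)
  have "?R m \<theta> * (?R n \<theta> * ?W \<theta>) = (\<Sum>i\<le>m. \<Sum>k\<le>n. G i k \<theta>)" for \<theta>
  proof -
    have "?R m \<theta> * (?R n \<theta> * ?W \<theta>) = (\<Sum>i\<le>m. \<Sum>k\<le>n. ?f m i * cis (of_int (int m - 2 * int i) * \<theta>)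
         * (?f n k * cis (of_int (int n - 2 * int k) * \<theta>)) * ?W \<theta>)"
    proof -
      have "(?R m \<theta> * ?R n \<theta>) * ?W \<theta> = (\<Sum>i\<le>m. \<Sum>k\<le>n. ?f m i * cis (of_int (int m - 2 * int i) * \<theta>)
         * (?f n k * cis (of_int (int n - 2 * int k) * \<theta>)) * ?W \<theta>)"
        unfolding rogers_sum_circle sum_product unfolding sum_distrib_right ..
      then show ?thesis unfolding mult.assoc[of "?R m \<theta>", symmetric] .
    qed
    also have "\<dots> = (\<Sum>i\<le>m. \<Sum>k\<le>n. G i k \<theta>)"
    proof (intro sum.cong refl)
      fix i k
      have e: "cis (of_int (int m - 2 * int i) * \<theta>) * cis (of_int (int n - 2 * int k) * \<theta>)
          = cis (of_int (int (m + n) - 2 * (int i + int k)) * \<theta>)"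
        by (simp add: cis_mult algebra_simps)
      show "?f m i * cis (of_int (int m - 2 * int i) * \<theta>) * (?f n k * cis (of_int (int n - 2 * int k) * \<theta>)) * ?W \<theta>
          = G i k \<theta>" unfolding G_def e[symmetric] by (simp only: mult_ac)
    qed
    finally show ?thesis .
  qed
  then have "integral {- pi..pi} (\<lambda>\<theta>. ?R m \<theta> * (?R n \<theta> * ?W \<theta>)) = (\<Sum>i\<le>m. \<Sum>k\<le>n. integral {- pi..pi} (G i k))"
    using int by (simp add: integral_sum integrable_sum)
  also have "\<dots> = (\<Sum>i\<le>m. \<Sum>k\<le>n. ?f m i * ?f n k * (if even (m + n) then
      2 * pi * (fourier_int a q ((int (m + n) - 2 * (int i + int k)) div 2)
        - fourier_int a q ((int (m + n) - 2 * (int i + int k)) div 2 - 1)) else 0))"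
    unfolding G_def integral_mult_right circle_weight_moment[OF q a0 a1] by simp
  also have "\<dots> = 2 * (if m = n then rogers_norm a q n else 0)"
  proof (cases "even (m + n)")
    case False
    then have "m \<noteq> n" by auto
    then show ?thesis using False by simp
  next
    case True
    then obtain N where N: "m + n = 2 * N" by blast
    have h: "(int (m + n) - 2 * (int i + int k)) div 2 = int N - int i - int k" for i k
      unfolding N by simp
    have "(\<Sum>i\<le>m. \<Sum>k\<le>n. ?f m i * ?f n k * (if even (m + n) then
      2 * pi * (fourier_int a q ((int (m + n) - 2 * (int i + int k)) div 2)
        - fourier_int a q ((int (m + n) - 2 * (int i + int k)) div 2 - 1)) else 0))
      = 2 * pi * (\<Sum>i\<le>m. \<Sum>k\<le>n. ?f m i * ?f n k * (fourier_int a q (int N - int i - int k)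
        - fourier_int a q (int N - int i - int k - 1)))"
      unfolding h sum_distrib_left by (intro sum.cong refl) (simp only: True if_True mult_ac)
    then show ?thesis unfolding rogers_double_sum[OF q q0 a0 a1 N mn]
      by (simp add: rogers_norm_def)
  qed
  finally have full: "integral {- pi..pi} (\<lambda>\<theta>. ?R m \<theta> * (?R n \<theta> * ?W \<theta>)) = 2 * (if m = n then rogers_norm a q n else 0)" .
  have "?W (- \<theta>) = ?W \<theta>" for \<theta>
    by (simp add: circle_weight_def mult_ac)
  then have "integral {0..pi} (\<lambda>\<theta>. ?R m \<theta> * (?R n \<theta> * ?W \<theta>)) = integral {- pi..pi} (\<lambda>\<theta>. ?R m \<theta> * (?R n \<theta> * ?W \<theta>)) / 2"
    by (intro integral_even continuous_intros cW) (simp_all add: rogers_sum_swap[of a q _ "cis (- x)" "cis x" for x])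
  then show ?thesis unfolding full by simp
qed

theorem rogers_orthogonal:
  assumes q: "norm q < 1" and q0: "q \<noteq> 0" and a0: "a \<noteq> 0" and a1: "norm a < 1"
  shows "integral {0..pi} (\<lambda>\<theta>. rogers_sum a q m (cis \<theta>) (cis (- \<theta>)) * (rogers_sum a q n (cis \<theta>) (cis (- \<theta>)) * circle_weight a q \<theta>))
       = (if m = n then rogers_norm a q n else 0)"
proof (cases "m \<le> n")
  case True
  then show ?thesis by (rule rogers_orthogonal_le[OF q q0 a0 a1])
next
  case False
  then show ?thesis using rogers_orthogonal_le[OF q q0 a0 a1, of n m] by (simp add: mult.left_commute)
qed

section \<open>The generating function\<close>

text \<open>Summation by diagonals of a double series dominated by a double geometric series. Unlike the
  Cauchy product, the terms need not factor; the generating function has \<open>(\<gamma>;q)\<^bsub>k+j\<^esub>\<close>.\<close>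
lemma triangular_sums:
  fixes f :: "nat \<Rightarrow> nat \<Rightarrow> complex"
  assumes bound: "\<And>k j. norm (f k j) \<le> C * r ^ (k + j)" and r: "0 \<le> r" "r < 1"
    and inner: "\<And>k. (\<lambda>j. f k j) sums g k"
  shows "summable g" and "(\<lambda>m. \<Sum>k\<le>m. f k (m - k)) sums (\<Sum>k. g k)"
proof -
  have geo: "(\<lambda>k. r ^ k) summable_on (UNIV :: nat set)"
    using r by (intro norm_summable_imp_summable_on) simp
  have "(\<lambda>(k, j). r ^ k * r ^ j) summable_on (UNIV :: nat set) \<times> (UNIV :: nat set)"
  proof (rule summable_on_SigmaI)
    have "((\<lambda>j. r ^ j) has_sum (\<Sum>\<^sub>\<infinity>j. r ^ j)) (UNIV :: nat set)" using geo by (rule has_sum_infsum)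
    then show "((\<lambda>j. case (k, j) of (k, j) \<Rightarrow> r ^ k * r ^ j) has_sum (r ^ k * (\<Sum>\<^sub>\<infinity>j. r ^ j))) (UNIV :: nat set)" for k :: nat
      by (simp add: has_sum_cmult_right)
    show "(\<lambda>k. r ^ k * (\<Sum>\<^sub>\<infinity>j. r ^ j)) summable_on (UNIV :: nat set)"
      using geo by (rule summable_on_cmult_left)
  qed (use r in auto)
  then have "(\<lambda>(k, j). C * r ^ (k + j)) summable_on (UNIV :: (nat \<times> nat) set)"
    using summable_on_cmult_right[of "\<lambda>(k, j). r ^ k * r ^ j" UNIV C] by (simp add: case_prod_unfold power_add)
  then have "(\<lambda>x. norm (case x of (k, j) \<Rightarrow> f k j)) summable_on UNIV"
    by (rule Infinite_Sum.abs_summable_on_comparison_test') (use bound in auto)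
  then have "(\<lambda>(k, j). f k j) summable_on UNIV" by (rule abs_summable_summable)
  then obtain S where S: "((\<lambda>(k, j). f k j) has_sum S) UNIV" unfolding summable_on_def by blast
  have "(g has_sum S) UNIV"
  proof (rule has_sum_Sigma')
    show "((\<lambda>(k, j). f k j) has_sum S) (Sigma UNIV (\<lambda>_. UNIV))" using S by simp
    fix k
    have "summable (\<lambda>j. norm (f k j))"
    proof (rule summable_comparison_test)
      show "\<exists>N. \<forall>j\<ge>N. norm (norm (f k j)) \<le> C * r ^ k * r ^ j"
        using bound[of k] by (simp add: power_add mult_ac)
      show "summable (\<lambda>j. C * r ^ k * r ^ j)" using r by (intro summable_mult summable_geometric) simp
    qed
    from norm_summable_imp_has_sum[OF this inner]
    show "((\<lambda>j. case (k, j) of (k, j) \<Rightarrow> f k j) has_sum g k) UNIV" by simp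
  qed
  then have g: "g sums S" by (rule has_sum_imp_sums)
  then show "summable g" by (rule sums_summable)
  have 1: "(\<Sum>k. g k) = S" using g by (rule sums_unique[symmetric])
  have "((\<lambda>(m, k). f k (m - k)) has_sum S) (SIGMA m:UNIV. {..m})"
    using S by (subst has_sum_reindex_bij_witness[where i = "\<lambda>(k, j). (k + j, k)" and j = "\<lambda>(m, k). (k, m - k)"
        and T = UNIV and h = "\<lambda>(k, j). f k j" and s' = S]) auto
  then have "((\<lambda>m. \<Sum>k\<le>m. f k (m - k)) has_sum S) UNIV"
    by (rule has_sum_Sigma') (auto intro!: has_sum_finite)
  then show "(\<lambda>m. \<Sum>k\<le>m. f k (m - k)) sums (\<Sum>k. g k)"
    unfolding 1 by (rule has_sum_imp_sums)
qed

text \<open>Expand \<open>(b z\<^sup>2;q)\<^sub>k\<close> in powers of \<open>b z\<^sup>2\<close> by the finite \<open>q\<close>-binomial theorem, which is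
  \<open>q_chu_vandermonde\<close> at \<open>a = 0\<close>. Then the coefficient of \<open>z\<^bsup>m-r\<^esup> w\<^sup>r\<close> is again a
  \<open>q\<close>-Chu--Vandermonde sum, now at \<open>a = b q\<^sup>r\<close>.\<close>
lemma rogers_sum_q_expansion:
  assumes q: "norm q < 1" and b: "norm b < 1" and zw: "z * w = 1"
  shows "(\<Sum>k\<le>m. qpoch b q k * qpoch (b * z\<^sup>2) q k / (qpoch q q k * qpoch (b\<^sup>2) q k * qpoch q q (m - k))
            * z ^ (m - k) * w ^ k)
       = rogers_sum b q m z w / qpoch (b\<^sup>2) q m"
proof -
  define v where "v r i = qpoch b q (r + i) / (qpoch (b\<^sup>2) q (r + i) * qpoch q q (m - (r + i)))
      * ((- b) ^ i * q ^ (i choose 2) / (qpoch q q i * qpoch q q r)) * z ^ (m - r) * w ^ r" for r i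
  have b2: "norm (b\<^sup>2) < 1" using b by (simp add: norm_power power_less_one_iff)
  have "qpoch b q k * qpoch (b * z\<^sup>2) q k / (qpoch q q k * qpoch (b\<^sup>2) q k * qpoch q q (m - k)) * z ^ (m - k) * w ^ k
      = (\<Sum>i\<le>k. v (k - i) i)" if k: "k \<le> m" for k
  proof -
    have "qpoch (b * z\<^sup>2) q k / qpoch q q k = (\<Sum>i\<le>k. (- (b * z\<^sup>2)) ^ i * q ^ (i choose 2) / (qpoch q q i * qpoch q q (k - i)))"
      using q_chu_vandermonde[OF q, where a = 0 and b = "b * z\<^sup>2" and p = k]
      by (simp add: qbinom_coeff_def qpoch_def[of 0])
    note expand = this
    have "qpoch b q k * qpoch (b * z\<^sup>2) q k / (qpoch q q k * qpoch (b\<^sup>2) q k * qpoch q q (m - k)) * z ^ (m - k) * w ^ k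
        = qpoch b q k / (qpoch (b\<^sup>2) q k * qpoch q q (m - k)) * z ^ (m - k) * w ^ k * (qpoch (b * z\<^sup>2) q k / qpoch q q k)"
      by (simp add: mult_ac)
    also have "\<dots> = qpoch b q k / (qpoch (b\<^sup>2) q k * qpoch q q (m - k)) * z ^ (m - k) * w ^ k
          * (\<Sum>i\<le>k. (- (b * z\<^sup>2)) ^ i * q ^ (i choose 2) / (qpoch q q i * qpoch q q (k - i)))"
      unfolding expand ..
    also have "\<dots> = (\<Sum>i\<le>k. v (k - i) i)"
      unfolding sum_distrib_left
    proof (intro sum.cong refl)
      fix i assume i: "i \<in> {..k}"
      then obtain r where r: "k = r + i" by (metis atMost_iff le_add_diff_inverse2)
      obtain d where d: "m = r + i + d" using k r le_Suc_ex by blast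
      have "z ^ d * w ^ (r + i) * (z\<^sup>2) ^ i = z ^ (i + d) * w ^ r * (z * w) ^ i"
        by (simp add: power_add power_mult_distrib power2_eq_square mult_ac)
      then have e: "z ^ d * w ^ (r + i) * (z\<^sup>2) ^ i = z ^ (i + d) * w ^ r" using zw by simp
      have s: "m - k = d" "k - i = r" "m - (r + i) = d" "m - r = i + d" using r d by auto
      have "(- (b * z\<^sup>2)) ^ i = (- b) ^ i * (z\<^sup>2) ^ i" by (simp flip: power_mult_distrib)
      then have "qpoch b q k / (qpoch (b\<^sup>2) q k * qpoch q q d) * z ^ d * w ^ k
          * ((- (b * z\<^sup>2)) ^ i * q ^ (i choose 2) / (qpoch q q i * qpoch q q r))
         = qpoch b q k / (qpoch (b\<^sup>2) q k * qpoch q q d) * ((- b) ^ i * q ^ (i choose 2) / (qpoch q q i * qpoch q q r))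
           * (z ^ d * w ^ k * (z\<^sup>2) ^ i)" by (simp only: times_divide_eq_left times_divide_eq_right mult_ac)
      note main = this[unfolded r e, folded r]
      show "qpoch b q k / (qpoch (b\<^sup>2) q k * qpoch q q (m - k)) * z ^ (m - k) * w ^ k
          * ((- (b * z\<^sup>2)) ^ i * q ^ (i choose 2) / (qpoch q q i * qpoch q q (k - i))) = v (k - i) i"
        unfolding s v_def r[symmetric] main by (simp only: mult.assoc)
    qed
    finally show ?thesis .
  qed
  then have "(\<Sum>k\<le>m. qpoch b q k * qpoch (b * z\<^sup>2) q k / (qpoch q q k * qpoch (b\<^sup>2) q k * qpoch q q (m - k))
            * z ^ (m - k) * w ^ k) = (\<Sum>k\<le>m. \<Sum>i\<le>k. v (k - i) i)"
    by (intro sum.cong) auto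
  also have "\<dots> = (\<Sum>(k, i)\<in>(SIGMA k:{..m}. {..k}). v (k - i) i)" by (rule sum.Sigma) auto
  also have "\<dots> = (\<Sum>(r, i)\<in>(SIGMA r:{..m}. {..m - r}). v r i)"
    by (rule sum.reindex_bij_witness[where i = "\<lambda>(r, i). (r + i, i)" and j = "\<lambda>(k, i). (k - i, i)"]) auto
  also have "\<dots> = (\<Sum>r\<le>m. \<Sum>i\<le>m - r. v r i)" by (rule sum.Sigma[symmetric]) auto
  also have "\<dots> = (\<Sum>r\<le>m. qbinom_coeff b q r * qbinom_coeff b q (m - r) * z ^ (m - r) * w ^ r / qpoch (b\<^sup>2) q m)"
  proof (intro sum.cong refl)
    fix r assume r: "r \<in> {..m}"
    define p where "p = m - r"
    have "v r i = qpoch b q r / qpoch q q r / qpoch (b\<^sup>2) q m * z ^ p * w ^ r *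
       ((- b) ^ i * q ^ (i choose 2) * qpoch (b * q ^ r) q i * qpoch (b * q ^ r * b * q ^ i) q (p - i)
            / (qpoch q q i * qpoch q q (p - i)))" if i: "i \<in> {..p}" for i
    proof -
      have m: "m = (r + i) + (p - i)" and s: "m - (r + i) = p - i" using i r unfolding p_def by auto
      have "qpoch (b\<^sup>2) q m = qpoch (b\<^sup>2) q (r + i) * qpoch (b\<^sup>2 * q ^ (r + i)) q (p - i)"
        by (subst m) (rule qpoch_add)
      moreover have "b\<^sup>2 * q ^ (r + i) = b * q ^ r * b * q ^ i" by (simp add: power_add power2_eq_square mult_ac)
      ultimately have "qpoch (b\<^sup>2) q m = qpoch (b\<^sup>2) q (r + i) * qpoch (b * q ^ r * b * q ^ i) q (p - i)" by simp
      moreover have "qpoch (b\<^sup>2) q m \<noteq> 0" by (rule qpoch_nonzero[OF b2 q])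
      ultimately have inv: "1 / qpoch (b\<^sup>2) q (r + i) = qpoch (b * q ^ r * b * q ^ i) q (p - i) / qpoch (b\<^sup>2) q m"
        by (simp add: field_simps)
      have "v r i = 1 / qpoch (b\<^sup>2) q (r + i) * (qpoch b q r * qpoch (b * q ^ r) q i / qpoch q q (p - i)
         * ((- b) ^ i * q ^ (i choose 2) / (qpoch q q i * qpoch q q r)) * z ^ p * w ^ r)"
        unfolding v_def s p_def[symmetric] qpoch_add[of b] by (simp add: mult_ac)
      then show ?thesis unfolding inv by (simp add: mult_ac)
    qed
    then have "(\<Sum>i\<le>p. v r i) = qpoch b q r / qpoch q q r / qpoch (b\<^sup>2) q m * z ^ p * w ^ r * qbinom_coeff b q p"
      unfolding q_chu_vandermonde[OF q, where a = "b * q ^ r" and b = b and p = p, symmetric] sum_distrib_left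
      by (intro sum.cong) auto
    then show "(\<Sum>i\<le>m - r. v r i) = qbinom_coeff b q r * qbinom_coeff b q (m - r) * z ^ (m - r) * w ^ r / qpoch (b\<^sup>2) q m"
      by (simp add: p_def[symmetric] qbinom_coeff_def mult_ac)
  qed
  finally show ?thesis by (simp add: rogers_sum_def sum_divide_distrib)
qed

text \<open>Since \<open>(\<gamma>;q)\<^sub>k (\<gamma> q\<^sup>k;q)\<^sub>j = (\<gamma>;q)\<^bsub>k+j\<^esub>\<close>, expanding each quotient \<open>(\<gamma> t z q\<^sup>k;q)\<^sub>\<infinity> / (t z;q)\<^sub>\<infinity>\<close>
  by the \<open>q\<close>-binomial theorem leaves \<open>\<gamma>\<close> only in a factor depending on the total degree. Keeping the
  shifted product \<open>(\<gamma> t z q\<^sup>k;q)\<^sub>\<infinity>\<close> in place of \<open>(\<gamma> t z;q)\<^sub>\<infinity> / (\<gamma> t z;q)\<^sub>k\<close> avoids the zeros of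
  \<open>(\<gamma> t z;q)\<^sub>k\<close>.\<close>
theorem rogers_generating_function:
  fixes b g t q z w :: complex
  assumes q: "norm q < 1" and b: "norm b < 1" and t: "norm t < 1"
    and z: "norm z = 1" and zw: "z * w = 1"
  defines "h \<equiv> \<lambda>k. qpoch g q k * qpoch b q k * qpoch (b * z\<^sup>2) q k / (qpoch q q k * qpoch (b\<^sup>2) q k) * (t * w) ^ k
        * (qpoch_inf (g * t * z * q ^ k) q / qpoch_inf (t * z) q)"
  shows "summable h"
    and "(\<lambda>m. qpoch g q m / qpoch (b\<^sup>2) q m * rogers_sum b q m z w * t ^ m) sums (\<Sum>k. h k)"
proof -
  have b2: "norm (b\<^sup>2) < 1" using b by (simp add: norm_power power_less_one_iff)
  have w: "norm w = 1" using arg_cong[OF zw, of norm] z by (simp add: norm_mult)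
  have tz: "norm (t * z) < 1" using t z by (simp add: norm_mult)
  define p where "p k = qpoch b q k * qpoch (b * z\<^sup>2) q k / (qpoch q q k * qpoch (b\<^sup>2) q k)" for k
  define f where "f k j = qpoch g q (k + j) * p k / qpoch q q j * z ^ j * w ^ k * t ^ (k + j)" for k j
  obtain M1 where M1: "M1 > 0" "\<And>n. norm (qpoch g q n) \<le> M1" using qpoch_bounded[OF q, of g] by auto
  obtain M2 where M2: "M2 > 0" "\<And>n. norm (qpoch b q n / qpoch q q n) \<le> M2" using qpoch_quotient_bounded[OF q q, of b] by auto
  obtain M3 where M3: "M3 > 0" "\<And>n. norm (qpoch (b * z\<^sup>2) q n / qpoch (b\<^sup>2) q n) \<le> M3"
    using qpoch_quotient_bounded[OF b2 q, of "b * z\<^sup>2"] by auto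
  obtain M4 where M4: "M4 > 0" "\<And>n. norm (qpoch 0 q n / qpoch q q n) \<le> M4" using qpoch_quotient_bounded[OF q q, of 0] by auto
  have f_bound: "norm (f k j) \<le> M1 * (M2 * M3) * M4 * norm t ^ (k + j)" for k j
  proof -
    have "f k j = qpoch g q (k + j) * ((qpoch b q k / qpoch q q k) * (qpoch (b * z\<^sup>2) q k / qpoch (b\<^sup>2) q k))
       * (qpoch 0 q j / qpoch q q j) * t ^ (k + j) * (z ^ j * w ^ k)"
      by (simp add: f_def p_def qpoch_def[of 0])
    also have "norm \<dots> = norm (qpoch g q (k + j)) * (norm (qpoch b q k / qpoch q q k) * norm (qpoch (b * z\<^sup>2) q k / qpoch (b\<^sup>2) q k))
       * norm (qpoch 0 q j / qpoch q q j) * norm t ^ (k + j)"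
      by (simp only: norm_mult norm_power z w power_one mult_1_right)
    also have "\<dots> \<le> M1 * (M2 * M3) * M4 * norm t ^ (k + j)"
      using M1 M2 M3 M4 by (intro mult_mono mult_nonneg_nonneg) (auto simp: less_imp_le)
    finally show ?thesis .
  qed
  have h: "h k = qpoch g q k * p k * (t * w) ^ k * (qpoch_inf (g * t * z * q ^ k) q / qpoch_inf (t * z) q)" for k
    by (simp add: h_def p_def mult.assoc)
  have inner: "(\<lambda>j. f k j) sums h k" for k
  proof -
    have "(\<lambda>j. qpoch g q k * p k * (t * w) ^ k * (qbinom_coeff (g * q ^ k) q j * (t * z) ^ j)) sums
        (qpoch g q k * p k * (t * w) ^ k * (qpoch_inf (g * q ^ k * (t * z)) q / qpoch_inf (t * z) q))"
      by (intro sums_mult q_binomial q tz)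
    moreover have "g * q ^ k * (t * z) = g * t * z * q ^ k" by simp
    moreover have "qpoch g q k * p k * (t * w) ^ k * (qbinom_coeff (g * q ^ k) q j * (t * z) ^ j) = f k j" for j
      unfolding f_def qpoch_add by (simp add: qbinom_coeff_def power_add power_mult_distrib mult_ac)
    ultimately show ?thesis unfolding h by simp
  qed
  show "summable h"
    by (rule triangular_sums(1)[OF f_bound _ _ inner]) (use t in auto)
  have "(\<lambda>m. \<Sum>k\<le>m. f k (m - k)) sums (\<Sum>k. h k)"
    by (rule triangular_sums(2)[OF f_bound _ _ inner]) (use t in auto)
  moreover have "(\<Sum>k\<le>m. f k (m - k)) = qpoch g q m / qpoch (b\<^sup>2) q m * rogers_sum b q m z w * t ^ m" for m
  proof -
    have "(\<Sum>k\<le>m. f k (m - k)) = qpoch g q m * t ^ m * (\<Sum>k\<le>m. qpoch b q k * qpoch (b * z\<^sup>2) q k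
        / (qpoch q q k * qpoch (b\<^sup>2) q k * qpoch q q (m - k)) * z ^ (m - k) * w ^ k)"
      unfolding sum_distrib_left by (intro sum.cong) (auto simp: f_def p_def)
    then show ?thesis unfolding rogers_sum_q_expansion[OF q b zw] by simp
  qed
  ultimately show "(\<lambda>m. qpoch g q m / qpoch (b\<^sup>2) q m * rogers_sum b q m z w * t ^ m) sums (\<Sum>k. h k)"
    by simp
qed

section \<open>Translation to the hypergeometric definitions\<close>

lemma powi_reciprocal:
  fixes q :: complex
  assumes "q \<noteq> 0"
  shows "q powi (- int n) = 1 / q ^ n" "q powi (1 - int n) = q / q ^ n"
  using assms by (simp_all add: power_int_minus power_int_diff divide_inverse)

lemma rogers_poly_coeff:
  assumes q: "norm q < 1" and q0: "q \<noteq> 0" and b: "norm b < 1" and b0: "b \<noteq> 0" and k: "k \<le> n"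
  shows "qbinom_coeff b q n * (qpoch (1 / q ^ n) q k / qpoch (q / (b * q ^ n)) q k) * (q / b) ^ k
       = qbinom_coeff b q (n - k)"
  using k
proof (induction k)
  case 0
  show ?case by simp
next
  case (Suc k)
  then obtain d where d: "n = Suc (k + d)" using less_imp_Suc_add[of k n] by auto
  have s: "n - k = Suc d" "n - Suc k = d" using d by auto
  have nz: "1 - b * q ^ d \<noteq> 0" "1 - q * q ^ d \<noteq> 0"
    using one_minus_nonzero[OF b q] one_minus_power_nonzero[OF q] by auto
  have den: "(1 - q / (b * q ^ n) * q ^ k) * (b * q ^ d) = b * q ^ d - 1"
    using q0 b0 unfolding d by (simp add: power_add field_simps)
  have fac: "(1 - 1 / q ^ n * q ^ k) / (1 - q / (b * q ^ n) * q ^ k) * (q / b) = (1 - q * q ^ d) / (1 - b * q ^ d)"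
  proof -
    have "(1 - 1 / q ^ n * q ^ k) * q / b * (b * q ^ d) = q * q ^ d - 1"
      using q0 b0 unfolding d by (simp add: power_add field_simps)
    moreover note den
    moreover have "b * q ^ d \<noteq> 0" using q0 b0 by simp
    ultimately have "(1 - 1 / q ^ n * q ^ k) * q / b / (1 - q / (b * q ^ n) * q ^ k) = (q * q ^ d - 1) / (b * q ^ d - 1)"
      by (metis mult_divide_mult_cancel_right)
    then show ?thesis by (metis (no_types, lifting) minus_diff_eq minus_divide_divide times_divide_eq_left times_divide_eq_right)
  qed
  have "qbinom_coeff b q n * (qpoch (1 / q ^ n) q (Suc k) / qpoch (q / (b * q ^ n)) q (Suc k)) * (q / b) ^ Suc k
     = (qbinom_coeff b q n * (qpoch (1 / q ^ n) q k / qpoch (q / (b * q ^ n)) q k) * (q / b) ^ k)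
       * ((1 - 1 / q ^ n * q ^ k) / (1 - q / (b * q ^ n) * q ^ k) * (q / b))"
    by (simp add: qpoch_Suc mult_ac)
  also have "\<dots> = qbinom_coeff b q (Suc d) * ((1 - q * q ^ d) / (1 - b * q ^ d))"
    using Suc unfolding fac s(1) by simp
  also have "\<dots> = (1 - q * q ^ d) * qbinom_coeff b q (Suc d) / (1 - b * q ^ d)" by simp
  also have "\<dots> = qbinom_coeff b q d" unfolding qbinom_coeff_Suc[OF q] using nz by simp
  finally show ?case unfolding s(2) .
qed

text \<open>The terms of the \<open>2\<phi>1\<close> beyond \<open>n\<close> vanish with \<open>(q\<^sup>-\<^sup>n;q)\<^sub>k\<close>, whatever their denominators are; up
  to \<open>n\<close> the denominators are nonzero because \<open>b\<close> has modulus less than 1.\<close>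
lemma rogers_poly_eq:
  assumes q: "norm q < 1" and q0: "q \<noteq> 0" and b: "norm b < 1" and b0: "b \<noteq> 0"
  shows "rogers_poly n x b q = rogers_sum b q n (cis (arccos x)) (cis (- arccos x))"
proof -
  define z where "z = cis (arccos x)"
  define w where "w = cis (- arccos x)"
  have zw: "z * w = 1" by (simp add: z_def w_def cis_mult)
  define T where "T k = qpoch (1 / q ^ n) q k * qpoch b q k / (qpoch q q k * qpoch (q / (b * q ^ n)) q k)
     * (q / b * w\<^sup>2) ^ k" for k
  have "w\<^sup>2 = cis (- 2 * arccos x)" unfolding w_def Complex.DeMoivre by simp
  then have "rogers_poly n x b q = qbinom_coeff b q n * z ^ n * (\<Sum>k. T k)"
    unfolding rogers_poly_def basic_hyp_def Let_def T_def qpochs_def powi_reciprocal[OF q0] z_def Complex.DeMoivre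
    by (simp add: qbinom_coeff_def divide_inverse mult_ac)
  also have "(\<Sum>k. T k) = (\<Sum>k\<le>n. T k)"
  proof (rule suminf_finite)
    fix k assume "k \<notin> {..n}"
    then have "qpoch (1 / q ^ n) q k = 0"
      unfolding qpoch_def using q0 by (intro prod_zero) (auto intro!: bexI[of _ n])
    then show "T k = 0" by (simp add: T_def)
  qed simp
  also have "qbinom_coeff b q n * z ^ n * (\<Sum>k\<le>n. T k) = rogers_sum b q n z w"
    unfolding rogers_sum_def sum_distrib_left
  proof (intro sum.cong refl)
    fix k assume k: "k \<in> {..n}"
    then obtain d where d: "n = k + d" using le_Suc_ex by blast
    have "z ^ n * (w\<^sup>2) ^ k = z ^ d * w ^ k * (z * w) ^ k"
      unfolding d by (simp add: power_add power_mult_distrib power2_eq_square mult_ac)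
    then have e: "z ^ n * (w\<^sup>2) ^ k = z ^ (n - k) * w ^ k" using zw d by simp
    have "qbinom_coeff b q n * z ^ n * T k
      = (qbinom_coeff b q n * (qpoch (1 / q ^ n) q k / qpoch (q / (b * q ^ n)) q k) * (q / b) ^ k)
        * qbinom_coeff b q k * (z ^ n * (w\<^sup>2) ^ k)"
      unfolding T_def qbinom_coeff_def power_mult_distrib[of "q / b"] by (simp add: mult_ac)
    also have "\<dots> = qbinom_coeff b q k * qbinom_coeff b q (n - k) * z ^ (n - k) * w ^ k"
      using k unfolding e by (subst rogers_poly_coeff[OF q q0 b b0]) (auto simp: mult_ac)
    finally show "qbinom_coeff b q n * z ^ n * T k = qbinom_coeff b q k * qbinom_coeff b q (n - k) * z ^ (n - k) * w ^ k" .
  qed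
  finally show ?thesis by (simp add: z_def w_def)
qed

lemma cnj_qpoch_inf:
  assumes "norm q < 1"
  shows "cnj (qpoch_inf a q) = qpoch_inf (cnj a) (cnj q)"
proof (rule LIMSEQ_unique)
  have "(\<lambda>n. cnj (qpoch a q n)) \<longlonglongrightarrow> cnj (qpoch_inf a q)"
    by (intro tendsto_cnj qpoch_LIMSEQ assms)
  then show "qpoch (cnj a) (cnj q) \<longlonglongrightarrow> cnj (qpoch_inf a q)"
    by (simp add: qpoch_def[abs_def])
  show "qpoch (cnj a) (cnj q) \<longlonglongrightarrow> qpoch_inf (cnj a) (cnj q)"
    using assms by (intro qpoch_LIMSEQ) simp
qed

lemma rogers_weight_eq:
  fixes \<alpha> q :: real
  assumes q: "\<bar>q\<bar> < 1" and a0: "\<alpha> \<noteq> 0" and a1: "\<bar>\<alpha>\<bar> < 1"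
  shows "complex_of_real (rogers_weight x \<alpha> q) = circle_weight \<alpha> q (arccos x)"
proof -
  define \<theta> where "\<theta> = arccos x"
  define A where "A = complex_of_real \<alpha>"
  define Q where "Q = complex_of_real q"
  have Q: "norm Q < 1" and A0: "A \<noteq> 0" and A1: "norm A < 1" using assms by (auto simp: A_def Q_def)
  have half: "qpoch_inf y Q / qpoch_inf (A * y) Q = (1 - y) * half_series A Q y" if "norm y = 1" for y
    unfolding half_series_eq[OF Q A0 A1, of y, OF eq_refl[OF that]]
    using qpoch_inf_split[OF Q, of y 1] by (simp add: qpoch_Suc mult.commute)
  have "complex_of_real (rogers_weight x A Q) = (qpoch_inf (cis (2 * \<theta>)) Q / qpoch_inf (A * cis (2 * \<theta>)) Q)
     * cnj (qpoch_inf (cis (2 * \<theta>)) Q / qpoch_inf (A * cis (2 * \<theta>)) Q)"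
    unfolding rogers_weight_def Let_def complex_norm_square \<theta>_def[symmetric] ..
  also have "cnj (qpoch_inf (cis (2 * \<theta>)) Q / qpoch_inf (A * cis (2 * \<theta>)) Q)
     = qpoch_inf (cis (- 2 * \<theta>)) Q / qpoch_inf (A * cis (- 2 * \<theta>)) Q"
    by (simp add: cnj_qpoch_inf[OF Q] cis_cnj) (simp add: A_def Q_def)
  finally show ?thesis
    unfolding half[OF norm_cis] circle_weight_def \<theta>_def[symmetric] A_def[symmetric] Q_def[symmetric]
    by (simp add: mult_ac)
qed

text \<open>The substitution \<open>x = cos \<theta>\<close>; the integrand on the left may be unbounded near the end points,
  while \<open>F\<close> is continuous up to them.\<close>
lemma integral_arccos_substitution:
  fixes F :: "real \<Rightarrow> complex"
  assumes F: "continuous_on {0..pi} F"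
  shows "((\<lambda>x. F (arccos x) * complex_of_real (1 / sqrt (1 - x\<^sup>2))) has_integral integral {0..pi} F) {-1<..<1}"
proof -
  have "((\<lambda>x. inverse (- sqrt (1 - x\<^sup>2)) *\<^sub>R F (arccos x)) has_integral
      (integral {arccos (- 1)..arccos 1} F - integral {arccos 1..arccos (- 1)} F)) {- 1..1}"
  proof (rule has_integral_substitution_general[where s = "{- 1, 1}" and c = 0 and d = pi])
    show "arccos ` {- 1..1} \<subseteq> {0..pi}" by (auto intro: arccos_lbound arccos_ubound)
    show "continuous_on {- 1..1} arccos" by (rule continuous_on_arccos')
    show "(arccos has_real_derivative inverse (- sqrt (1 - x\<^sup>2))) (at x within {- 1..1})"
      if "x \<in> {- 1..1} - {- 1, 1}" for x
      using that by (intro has_field_derivative_at_within[OF DERIV_arccos]) auto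
  qed (use F in auto)
  then have "((\<lambda>x. inverse (- sqrt (1 - x\<^sup>2)) *\<^sub>R F (arccos x)) has_integral (- integral {0..pi} F)) {- 1<..<1}"
    by (simp add: has_integral_Icc_iff_Ioo)
  from has_integral_neg[OF this] show ?thesis
    by (simp add: scaleR_conv_of_real mult.commute divide_inverse)
qed

lemma norm_rogers_sum_le:
  assumes M: "\<And>k. norm (qbinom_coeff b q k) \<le> M" and z: "norm z = 1" "norm w = 1"
  shows "norm (rogers_sum b q m z w) \<le> real (Suc m) * (M * M)"
proof -
  have M0: "0 \<le> M" using M[of 0] norm_ge_zero order_trans by blast
  have "norm (rogers_sum b q m z w) \<le> (\<Sum>k\<le>m. norm (qbinom_coeff b q k * qbinom_coeff b q (m - k) * z ^ (m - k) * w ^ k))"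
    unfolding rogers_sum_def by (rule norm_sum)
  also have "\<dots> \<le> (\<Sum>k\<le>m. M * M)"
    using M M0 z by (intro sum_mono) (auto simp: norm_mult norm_power intro!: mult_mono)
  finally show ?thesis by simp
qed

lemma rogers_connection_integral:
  assumes q: "norm q < 1" and q0: "q \<noteq> 0" and a0: "a \<noteq> 0" and a1: "norm a < 1"
  shows "integral {0..pi} (\<lambda>\<theta>. rogers_sum b q m (cis \<theta>) (cis (- \<theta>)) * (rogers_sum a q n (cis \<theta>) (cis (- \<theta>)) * circle_weight a q \<theta>))
       = (\<Sum>k\<le>m div 2. if m = n + 2 * k then connection_coeff a b q m k * rogers_norm a q n else 0)"
proof -
  let ?R = "\<lambda>a m \<theta>. rogers_sum a q m (cis \<theta>) (cis (- \<theta>))" and ?W = "circle_weight a q"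
  have cW: "continuous_on {0..pi} ?W"
    by (rule continuous_on_subset[OF circle_weight_continuous[OF q a0 a1]]) auto
  have int: "(\<lambda>\<theta>. ?R a l \<theta> * (?R a n \<theta> * ?W \<theta>)) integrable_on {0..pi}" for l
    by (intro integrable_continuous_interval continuous_intros cW)
  have "?R b m \<theta> * (?R a n \<theta> * ?W \<theta>)
      = (\<Sum>k\<le>m div 2. connection_coeff a b q m k * (?R a (m - 2 * k) \<theta> * (?R a n \<theta> * ?W \<theta>)))" for \<theta>
    by (subst rogers_connection[OF q a0 a1]) (simp_all add: cis_mult sum_distrib_right mult.assoc)
  then have "integral {0..pi} (\<lambda>\<theta>. ?R b m \<theta> * (?R a n \<theta> * ?W \<theta>))
      = (\<Sum>k\<le>m div 2. connection_coeff a b q m k * (if m - 2 * k = n then rogers_norm a q n else 0))"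
    by (simp only:) (subst integral_sum, auto intro!: integrable_on_mult_right int simp: rogers_orthogonal[OF q q0 a0 a1])
  also have "\<dots> = (\<Sum>k\<le>m div 2. if m = n + 2 * k then connection_coeff a b q m k * rogers_norm a q n else 0)"
    by (intro sum.cong) auto
  finally show ?thesis .
qed

section \<open>The integral of the generating function\<close>

text \<open>Term-by-term integration is justified by the majorant \<open>(m + 1) |t|\<^sup>m\<close>: a Rogers sum of degree
  \<open>m\<close> has \<open>m + 1\<close> terms, bounded uniformly in \<open>m\<close>. Only the degrees \<open>m = n + 2k\<close> contribute.\<close>
lemma rogers_generating_integral:
  fixes a b g t q :: complex and n :: nat
  assumes q: "norm q < 1" and q0: "q \<noteq> 0" and a0: "a \<noteq> 0" and a1: "norm a < 1"
    and b: "norm b < 1" and t: "norm t < 1"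
  defines "u \<equiv> \<lambda>m \<theta>. qpoch g q m / qpoch (b\<^sup>2) q m * rogers_sum b q m (cis \<theta>) (cis (- \<theta>)) * t ^ m
                * (rogers_sum a q n (cis \<theta>) (cis (- \<theta>)) * circle_weight a q \<theta>)"
  shows "continuous_on {0..pi} (\<lambda>\<theta>. \<Sum>m. u m \<theta>)"
    and "(\<lambda>k. qpoch g q (n + 2 * k) / qpoch (b\<^sup>2) q (n + 2 * k) * t ^ (n + 2 * k)
            * (connection_coeff a b q (n + 2 * k) k * rogers_norm a q n))
          sums integral {0..pi} (\<lambda>\<theta>. \<Sum>m. u m \<theta>)"
proof -
  let ?R = "\<lambda>a m \<theta>. rogers_sum a q m (cis \<theta>) (cis (- \<theta>))" and ?W = "circle_weight a q"
  have b2: "norm (b\<^sup>2) < 1" using b by (simp add: norm_power power_less_one_iff)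
  have cW: "continuous_on {0..pi} ?W"
    by (rule continuous_on_subset[OF circle_weight_continuous[OF q a0 a1]]) auto
  have "compact ((\<lambda>\<theta>. ?R a n \<theta> * ?W \<theta>) ` {0..pi})"
    by (intro compact_continuous_image continuous_intros cW) simp
  then have "bounded ((\<lambda>\<theta>. ?R a n \<theta> * ?W \<theta>) ` {0..pi})" by (rule compact_imp_bounded)
  then obtain D where D: "norm (?R a n \<theta> * ?W \<theta>) \<le> D" if "\<theta> \<in> {0..pi}" for \<theta>
    unfolding bounded_iff by blast
  have D0: "0 \<le> D" using D[of 0] norm_ge_zero order_trans by (metis atLeastAtMost_iff order_refl pi_ge_zero)
  obtain K where K: "K > 0" "\<And>m. norm (qpoch g q m / qpoch (b\<^sup>2) q m) \<le> K"
    using qpoch_quotient_bounded[OF b2 q, of g] by auto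
  obtain M where M: "M > 0" "\<And>m. norm (qbinom_coeff b q m) \<le> M"
    using qbinom_coeff_bounded[OF q, of b] by auto
  have cont: "continuous_on {0..pi} (u m)" for m
    unfolding u_def by (intro continuous_intros cW)
  have bound: "norm (u m \<theta>) \<le> K * (M * M) * D * (real (Suc m) * norm t ^ m)" if "\<theta> \<in> {0..pi}" for m \<theta>
  proof -
    have "norm (u m \<theta>) = norm (qpoch g q m / qpoch (b\<^sup>2) q m) * norm (?R b m \<theta>) * norm t ^ m * norm (?R a n \<theta> * ?W \<theta>)"
      unfolding u_def by (simp only: norm_mult norm_power)
    also have "\<dots> \<le> K * (real (Suc m) * (M * M)) * norm t ^ m * D"
      using K M D[OF that] D0 norm_rogers_sum_le[OF M(2), where z = "cis \<theta>" and w = "cis (- \<theta>)" and m = m]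
      by (intro mult_mono mult_nonneg_nonneg) (auto simp: less_imp_le)
    finally show ?thesis by (simp only: mult_ac)
  qed
  have "summable (\<lambda>m. diffs (\<lambda>_. 1) m * norm t ^ m)"
    by (rule termdiff_converges[where K = 1]) (use t in auto)
  then have summ: "summable (\<lambda>m. K * (M * M) * D * (real (Suc m) * norm t ^ m))"
    by (intro summable_mult) (simp add: diffs_def)
  show "continuous_on {0..pi} (\<lambda>\<theta>. \<Sum>m. u m \<theta>)"
    by (rule integral_uniform_sums(2)[OF cont bound summ])
  have sums: "(\<lambda>m. integral {0..pi} (u m)) sums integral {0..pi} (\<lambda>\<theta>. \<Sum>m. u m \<theta>)"
    by (rule integral_uniform_sums(1)[OF cont bound summ])
  have int: "integral {0..pi} (u m) = qpoch g q m / qpoch (b\<^sup>2) q m * t ^ m *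
     (\<Sum>k\<le>m div 2. if m = n + 2 * k then connection_coeff a b q m k * rogers_norm a q n else 0)" for m
  proof -
    have "u m = (\<lambda>\<theta>. qpoch g q m / qpoch (b\<^sup>2) q m * t ^ m * (?R b m \<theta> * (?R a n \<theta> * ?W \<theta>)))"
      unfolding u_def by (simp add: mult_ac)
    then show ?thesis by (simp add: rogers_connection_integral[OF q q0 a0 a1])
  qed
  have "integral {0..pi} (u m) = 0" if "m \<notin> range (\<lambda>k. n + 2 * k)" for m
    unfolding int using that by (subst sum.neutral) auto
  then have "(\<lambda>k. integral {0..pi} (u (n + 2 * k))) sums integral {0..pi} (\<lambda>\<theta>. \<Sum>m. u m \<theta>)"
    using sums by (subst sums_mono_reindex) (auto simp: strict_mono_def)
  moreover have "(\<Sum>i\<le>(n + 2 * k) div 2. if n + 2 * k = n + 2 * i then connection_coeff a b q (n + 2 * k) i * rogers_norm a q n else 0)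
      = connection_coeff a b q (n + 2 * k) k * rogers_norm a q n" for k
    by (simp add: sum.delta')
  ultimately show "(\<lambda>k. qpoch g q (n + 2 * k) / qpoch (b\<^sup>2) q (n + 2 * k) * t ^ (n + 2 * k)
            * (connection_coeff a b q (n + 2 * k) k * rogers_norm a q n))
          sums integral {0..pi} (\<lambda>\<theta>. \<Sum>m. u m \<theta>)"
    unfolding int by simp
qed

text \<open>The reason for the square-root parameters of the \<open>6\<phi>5\<close>.\<close>
lemma qpoch_even_product:
  assumes "s\<^sup>2 = c" "s'\<^sup>2 = c * q"
  shows "qpoch s q k * qpoch (- s) q k * qpoch s' q k * qpoch (- s') q k = qpoch c q (2 * k)"
proof (induction k)
  case (Suc k)
  have p2: "q ^ (2 * k) = q ^ k * q ^ k" by (simp add: mult_2 power_add)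
  have "(1 - s * q ^ k) * (1 - - s * q ^ k) = 1 - s\<^sup>2 * q ^ (2 * k)"
    "(1 - s' * q ^ k) * (1 - - s' * q ^ k) = 1 - s'\<^sup>2 * q ^ (2 * k)"
    unfolding p2 by (simp_all add: power2_eq_square algebra_simps)
  then have e: "(1 - s * q ^ k) * (1 - - s * q ^ k) = 1 - c * q ^ (2 * k)"
    "(1 - s' * q ^ k) * (1 - - s' * q ^ k) = 1 - c * q ^ Suc (2 * k)"
    unfolding assms by (simp_all add: mult_ac)
  have "qpoch s q (Suc k) * qpoch (- s) q (Suc k) * qpoch s' q (Suc k) * qpoch (- s') q (Suc k)
    = (qpoch s q k * qpoch (- s) q k * qpoch s' q k * qpoch (- s') q k)
      * ((1 - s * q ^ k) * (1 - - s * q ^ k)) * ((1 - s' * q ^ k) * (1 - - s' * q ^ k))"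
    by (simp only: qpoch_Suc mult_ac)
  also have "\<dots> = qpoch c q (2 * Suc k)" unfolding e Suc by (simp add: qpoch_Suc)
  finally show ?case .
qed simp

text \<open>Separates the part of the \<open>k\<close>-th surviving term that does not depend on \<open>k\<close>. The factor
  \<open>1 - a q\<^sup>n\<close> of the connection coefficient completes \<open>(a;q)\<^sub>n\<close> from the norm to \<open>(a;q)\<^bsub>n+1\<^esub>\<close>,
  which cancels against the denominator.\<close>
lemma connection_norm_factor:
  assumes q: "norm q < 1" and a0: "a \<noteq> 0" and a1: "norm a < 1"
  shows "connection_coeff a b q (n + 2 * k) k * rogers_norm a q n
     = 2 * pi * (qpoch_inf a q * qpoch_inf (q * a) q * (qpoch (a\<^sup>2) q n * qpoch b q n)
         / (qpoch_inf (a\<^sup>2) q * qpoch_inf q q * (qpoch q q n * qpoch (q * a) q n)))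
       * (a ^ k * qpoch (b / a) q k * qpoch (b * q ^ n) q k / (qpoch q q k * qpoch (a * q ^ (n + 1)) q k))"
proof -
  have nz: "1 - a \<noteq> 0" "qpoch a q (Suc n) \<noteq> 0" using one_minus_nonzero[OF a1 q, of 0] qpoch_nonzero[OF a1 q] by auto
  have e: "qpoch a q (Suc (n + k)) = qpoch a q (Suc n) * qpoch (a * q ^ (n + 1)) q k"
    using qpoch_add[of a q "Suc n" k] by simp
  have s: "n + 2 * k - k = n + k" "n + 2 * k - 2 * k = n" by simp_all
  have "connection_coeff a b q (n + 2 * k) k * qpoch a q n
     = a ^ k * qbinom_coeff (b / a) q k * qpoch b q (n + k) * qpoch a q (Suc n) / qpoch a q (Suc (n + k))"
    unfolding connection_coeff_def qpoch_Suc[of a q n] s by (simp add: mult_ac)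
  also have "\<dots> = a ^ k * qbinom_coeff (b / a) q k * (qpoch b q n * qpoch (b * q ^ n) q k) / qpoch (a * q ^ (n + 1)) q k"
    unfolding e using nz(2) by (simp add: qpoch_add)
  finally have *: "connection_coeff a b q (n + 2 * k) k * qpoch a q n
     = a ^ k * qbinom_coeff (b / a) q k * (qpoch b q n * qpoch (b * q ^ n) q k) / qpoch (a * q ^ (n + 1)) q k" .
  have "connection_coeff a b q (n + 2 * k) k * rogers_norm a q n
     = 2 * pi * ((connection_coeff a b q (n + 2 * k) k * qpoch a q n)
       / qpoch q q n * fourier_diff a q 0 * qpoch (a\<^sup>2) q n / qpoch (q * a) q n)"
    unfolding rogers_norm_def qbinom_coeff_def[of a] by (simp add: mult_ac)
  then show ?thesis unfolding * fourier_diff_0[OF q a0 a1] qbinom_coeff_def by (simp add: mult_ac)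
qed

text \<open>Only the scaled series has to converge, because a nonzero scalar can be divided out.\<close>
lemma suminf_scaled:
  fixes c :: complex
  assumes "summable (\<lambda>k. c * f k)"
  shows "(\<Sum>k. c * f k) = c * (\<Sum>k. f k)"
proof (cases "c = 0")
  case False
  then show ?thesis using assms by (intro suminf_mult) (simp add: summable_cmult_iff)
qed simp

theorem corollary20:
  fixes n :: nat and \<gamma> t :: complex and \<alpha> \<beta> q :: real
  assumes "\<alpha> \<in> {-1<..<1} - {0}" and "\<beta> \<in> {-1<..<1} - {0}"
    and "0 < \<bar>q\<bar>" and "\<bar>q\<bar> < 1"
    and "norm t < 1 - \<beta>\<^sup>2"
  shows
    "let A = complex_of_real \<alpha>; B = complex_of_real \<beta>; Q = complex_of_real q in
     ((\<lambda>x. let \<theta> = arccos x in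
          qpoch_inf (\<gamma> * t * cis \<theta>) Q / qpoch_inf (t * cis \<theta>) Q *
          basic_hyp [\<gamma>, B, B * cis (2 * \<theta>)] [B\<^sup>2, \<gamma> * t * cis \<theta>] Q (t * cis (- \<theta>)) *
          rogers_poly n x A Q *
          complex_of_real (rogers_weight x A Q / sqrt (1 - x\<^sup>2)))
      has_integral
        2 * complex_of_real pi * t ^ n *
        (qpochs_inf [A, Q * A] Q * qpochs [A\<^sup>2, \<gamma>, B] Q n /
         (qpochs_inf [A\<^sup>2, Q] Q * qpochs [Q, B\<^sup>2, Q * A] Q n)) *
        basic_hyp
          [B / A, B * Q ^ n,
           csqrt (\<gamma> * Q ^ n), - csqrt (\<gamma> * Q ^ n),
           csqrt (\<gamma> * Q ^ (n + 1)), - csqrt (\<gamma> * Q ^ (n + 1))]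
          [A * Q ^ (n + 1),
           B * Q powr (of_nat n / 2), - (B * Q powr (of_nat n / 2)),
           B * Q powr (of_nat (n + 1) / 2), - (B * Q powr (of_nat (n + 1) / 2))]
          Q (A * t\<^sup>2))
      {-1<..<1}"
proof -
  define A where "A = complex_of_real \<alpha>"
  define B where "B = complex_of_real \<beta>"
  define Q where "Q = complex_of_real q"
  have A0: "A \<noteq> 0" and A1: "norm A < 1" and B1: "norm B < 1" and Q0: "Q \<noteq> 0" and Q1: "norm Q < 1"
    using assms by (auto simp: A_def B_def Q_def)
  have "0 \<le> \<beta>\<^sup>2" by simp
  then have t: "norm t < 1" using assms(5) by linarith
  define F where "F \<theta> = (\<Sum>m. qpoch \<gamma> Q m / qpoch (B\<^sup>2) Q m * rogers_sum B Q m (cis \<theta>) (cis (- \<theta>)) * t ^ m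
                * (rogers_sum A Q n (cis \<theta>) (cis (- \<theta>)) * circle_weight A Q \<theta>))" for \<theta>
  define I where "I x = (let \<theta> = arccos x in
          qpoch_inf (\<gamma> * t * cis \<theta>) Q / qpoch_inf (t * cis \<theta>) Q *
          basic_hyp [\<gamma>, B, B * cis (2 * \<theta>)] [B\<^sup>2, \<gamma> * t * cis \<theta>] Q (t * cis (- \<theta>)) *
          rogers_poly n x A Q *
          complex_of_real (rogers_weight x A Q / sqrt (1 - x\<^sup>2)))" for x
  \<comment> \<open>At these points some \<open>(\<gamma> t cis \<theta>;q)\<^sub>k\<close> in the denominators of the \<open>3\<phi>2\<close> vanishes and the integrand
    is only a default value. If \<open>\<gamma> t cis \<theta> q\<^sup>j = 1\<close>, then \<open>cis \<theta>\<close> is determined by \<open>j\<close> and \<open>x\<close> is its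
    real part, so there are countably many.\<close>
  define S where "S = (\<Union>j. {Re (1 / (\<gamma> * t * Q ^ j))})"
  define V where "V = 2 * complex_of_real pi * t ^ n *
        (qpochs_inf [A, Q * A] Q * qpochs [A\<^sup>2, \<gamma>, B] Q n /
         (qpochs_inf [A\<^sup>2, Q] Q * qpochs [Q, B\<^sup>2, Q * A] Q n))"
  define H where "H = basic_hyp
          [B / A, B * Q ^ n,
           csqrt (\<gamma> * Q ^ n), - csqrt (\<gamma> * Q ^ n),
           csqrt (\<gamma> * Q ^ (n + 1)), - csqrt (\<gamma> * Q ^ (n + 1))]
          [A * Q ^ (n + 1),
           B * Q powr (of_nat n / 2), - (B * Q powr (of_nat n / 2)),
           B * Q powr (of_nat (n + 1) / 2), - (B * Q powr (of_nat (n + 1) / 2))]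
          Q (A * t\<^sup>2)"
  have integrand: "I x = F (arccos x) * complex_of_real (1 / sqrt (1 - x\<^sup>2))"
    if x: "x \<in> {-1<..<1} - S" for x
  proof -
    define \<theta> where "\<theta> = arccos x"
    define z where "z = cis \<theta>"
    define w where "w = cis (- \<theta>)"
    have zw: "z * w = 1" by (simp add: z_def w_def cis_mult)
    have z2: "z\<^sup>2 = cis (2 * \<theta>)" unfolding z_def Complex.DeMoivre by simp
    have Re_z: "Re z = x" using x by (simp add: z_def \<theta>_def cos_arccos)
    have factor: "1 - \<gamma> * t * z * Q ^ j \<noteq> 0" for j
    proof
      assume "1 - \<gamma> * t * z * Q ^ j = 0"
      then have 1: "z * (\<gamma> * t * Q ^ j) = 1" by (simp add: algebra_simps)
      then have "\<gamma> * t * Q ^ j \<noteq> 0" by (metis mult_zero_right zero_neq_one)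
      with 1 have "z = 1 / (\<gamma> * t * Q ^ j)" by (simp add: eq_divide_eq)
      then have "x \<in> S" using Re_z unfolding S_def by blast
      then show False using x by blast
    qed
    then have nz: "qpoch (\<gamma> * t * z) Q k \<noteq> 0" for k by (simp add: qpoch_def)
    define h where "h k = qpoch \<gamma> Q k * qpoch B Q k * qpoch (B * z\<^sup>2) Q k / (qpoch Q Q k * qpoch (B\<^sup>2) Q k) * (t * w) ^ k
        * (qpoch_inf (\<gamma> * t * z * Q ^ k) Q / qpoch_inf (t * z) Q)" for k
    define T where "T k = qpochs [\<gamma>, B, B * z\<^sup>2] Q k / qpochs (Q # [B\<^sup>2, \<gamma> * t * z]) Q k *
         ((-1) ^ k * Q ^ (k choose 2)) powi (1 + int (length [B\<^sup>2, \<gamma> * t * z]) - int (length [\<gamma>, B, B * z\<^sup>2])) * (t * w) ^ k" for k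
    have gen: "(\<lambda>m. qpoch \<gamma> Q m / qpoch (B\<^sup>2) Q m * rogers_sum B Q m z w * t ^ m) sums (\<Sum>k. h k)"
      and h_summable: "summable h"
      unfolding h_def by (rule rogers_generating_function[OF Q1 B1 t _ zw], simp add: z_def)+
    have hT: "h = (\<lambda>k. qpoch_inf (\<gamma> * t * z) Q / qpoch_inf (t * z) Q * T k)"
    proof
      fix k
      show "h k = qpoch_inf (\<gamma> * t * z) Q / qpoch_inf (t * z) Q * T k"
        unfolding qpoch_inf_split[OF Q1, of "\<gamma> * t * z" k] h_def T_def using nz[of k]
        by (simp add: qpochs_def mult_ac)
    qed
    have "(\<Sum>k. h k) = qpoch_inf (\<gamma> * t * z) Q / qpoch_inf (t * z) Q * (\<Sum>k. T k)"
      using h_summable unfolding hT by (rule suminf_scaled)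
    then have "F \<theta> = qpoch_inf (\<gamma> * t * z) Q / qpoch_inf (t * z) Q * (\<Sum>k. T k) * (rogers_sum A Q n z w * circle_weight A Q \<theta>)"
      using sums_mult2[OF gen, of "rogers_sum A Q n z w * circle_weight A Q \<theta>"]
      unfolding F_def z_def[symmetric] w_def[symmetric] by (simp add: sums_iff)
    moreover have "rogers_poly n x A Q = rogers_sum A Q n z w"
      unfolding z_def w_def \<theta>_def by (rule rogers_poly_eq[OF Q1 Q0 A1 A0])
    moreover have "complex_of_real (rogers_weight x A Q) = circle_weight A Q \<theta>"
      unfolding A_def Q_def \<theta>_def by (rule rogers_weight_eq) (use assms in auto)
    moreover have "I x = qpoch_inf (\<gamma> * t * z) Q / qpoch_inf (t * z) Q * (\<Sum>k. T k) * rogers_poly n x A Q *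
          complex_of_real (rogers_weight x A Q / sqrt (1 - x\<^sup>2))"
      unfolding I_def Let_def basic_hyp_def T_def \<theta>_def[symmetric] z_def[symmetric] w_def[symmetric] z2[symmetric] ..
    ultimately show ?thesis by (simp add: \<theta>_def[symmetric])
  qed
  have Fc: "continuous_on {0..pi} F"
    unfolding F_def by (rule rogers_generating_integral(1)[OF Q1 Q0 A0 A1 B1 t])
  have "((\<lambda>x. F (arccos x) * complex_of_real (1 / sqrt (1 - x\<^sup>2))) has_integral integral {0..pi} F) {-1<..<1}"
    by (rule integral_arccos_substitution[OF Fc])
  moreover have "negligible S"
    unfolding S_def by (rule negligible_countable_Union) auto
  ultimately have int: "(I has_integral integral {0..pi} F) {-1<..<1}"
    using integrand by (rule has_integral_spike[rotated 2])
  have "integral {0..pi} F = V * H"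
  proof -
    define T where "T k = qpochs [B / A, B * Q ^ n,
           csqrt (\<gamma> * Q ^ n), - csqrt (\<gamma> * Q ^ n),
           csqrt (\<gamma> * Q ^ (n + 1)), - csqrt (\<gamma> * Q ^ (n + 1))] Q k
         / qpochs (Q # [A * Q ^ (n + 1),
           B * Q powr (of_nat n / 2), - (B * Q powr (of_nat n / 2)),
           B * Q powr (of_nat (n + 1) / 2), - (B * Q powr (of_nat (n + 1) / 2))]) Q k
         * ((-1) ^ k * Q ^ (k choose 2)) powi 0 * (A * t\<^sup>2) ^ k" for k
    have half_power: "(B * Q powr (of_nat m / 2))\<^sup>2 = B\<^sup>2 * Q ^ m" for m
    proof -
      have "(Q powr (of_nat m / 2))\<^sup>2 = Q powr (of_nat m / 2 + of_nat m / 2)"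
        by (simp only: powr_add power2_eq_square)
      also have "\<dots> = Q ^ m" using Q0 by (simp add: powr_nat' flip: add_divide_distrib)
      finally show ?thesis by (simp add: power_mult_distrib)
    qed
    have upper: "qpoch (csqrt (\<gamma> * Q ^ n)) Q k * qpoch (- csqrt (\<gamma> * Q ^ n)) Q k *
          qpoch (csqrt (\<gamma> * Q ^ (n + 1))) Q k * qpoch (- csqrt (\<gamma> * Q ^ (n + 1))) Q k
        = qpoch (\<gamma> * Q ^ n) Q (2 * k)" for k
      by (rule qpoch_even_product) simp_all
    have lower: "qpoch (B * Q powr (of_nat n / 2)) Q k * qpoch (- (B * Q powr (of_nat n / 2))) Q k *
          qpoch (B * Q powr (of_nat (n + 1) / 2)) Q k * qpoch (- (B * Q powr (of_nat (n + 1) / 2))) Q k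
        = qpoch (B\<^sup>2 * Q ^ n) Q (2 * k)" for k
      by (rule qpoch_even_product) (simp_all only: half_power, simp)
    have T: "T k = qpoch (B / A) Q k * qpoch (B * Q ^ n) Q k * qpoch (\<gamma> * Q ^ n) Q (2 * k)
         / (qpoch Q Q k * qpoch (A * Q ^ (n + 1)) Q k * qpoch (B\<^sup>2 * Q ^ n) Q (2 * k)) * (A * t\<^sup>2) ^ k" for k
      unfolding T_def upper[symmetric] lower[symmetric] by (simp add: qpochs_def mult_ac)
    have H: "H = (\<Sum>k. T k)" unfolding H_def basic_hyp_def T_def by simp
    have coeff_eq: "qpoch \<gamma> Q (n + 2 * k) / qpoch (B\<^sup>2) Q (n + 2 * k) * t ^ (n + 2 * k)
            * (connection_coeff A B Q (n + 2 * k) k * rogers_norm A Q n) = V * T k" for k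
      unfolding connection_norm_factor[OF Q1 A0 A1] T V_def qpoch_add[of \<gamma>] qpoch_add[of "B\<^sup>2"]
        power_add[of t] power_mult[of t] power_mult_distrib[of A]
      by (simp add: qpochs_def qpochs_inf_def mult_ac)
    have "(\<lambda>k. V * T k) sums integral {0..pi} F"
      using rogers_generating_integral(2)[OF Q1 Q0 A0 A1 B1 t, of \<gamma> n] unfolding coeff_eq F_def .
    then show ?thesis
      unfolding H using suminf_scaled[of V T] by (simp add: sums_iff)
  qed
  then show ?thesis using int
    unfolding Let_def A_def[symmetric] B_def[symmetric] Q_def[symmetric] V_def H_def I_def by simp
qed

end
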